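(* Let $\alpha\in(0,2)$, let $G$ be a countable group and let $\{X_t\}_{t\in G}$ be a stationary S$\alpha$S random field. (a) Suppose $(f^{(1)},\{\phi^{(1)}_t\},\{c^{(1)}_t\})$ is a Rosiński triplet of $\{X_t\}$ on $(S_1,\mu_1)$, let $\{\phi^{(2)}_t\}_{t\in G}$ be a nonsingular $G$-action on a $\sigma$-finite standard measure space $(S_2,\mu_2)$ with $\pm1$-valued cocycle $\{c^{(2)}_t\}_{t\in G}$, and assume $$\left(\{\phi^{(1)}_t\},\{c^{(1)}_t\}\right)\approx\left(\{\phi^{(2)}_t\},\{c^{(2)}_t\}\right)$$ via maps $h:S_1\to S_2$ and $b:S_2\to\{+1,-1\}$. Set $$f^{(2)}(s)=b(s)\left(\frac{d(\mu_1\circ h^{-1})}{d\mu_2}(s)\right)^{1/\alpha}f^{(1)}\circ h^{-1}(s),\qquad s\in S_2 .$$ Then $(f^{(2)},\{\phi^{(2)}_t\},\{c^{(2)}_t\})$ is also a Rosiński triplet of $\{X_t\}$, on $(S_2,\mu_2)$. Moreover, if $(f^{(1)},\{\phi^{(1)}_t\},\{c^{(1)}_t\})$ is minimal, then so is $(f^{(2)},\{\phi^{(2)}_t\},\{c^{(2)}_t\})$. (b) Conversely, if $(f^{(i)},\{\phi^{(i)}_t\},\{c^{(i)}_t\})$ is a minimal triplet of $\{X_t\}$ on $(S_i,\mu_i)$ for $i=1,2$, then $$\left(\{\phi^{(1)}_t\},\{c^{(1)}_t\}\right)\approx\left(\{\phi^{(2)}_t\},\{c^{(2)}_t\}\right).$$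 In particular, two group actions arising in two minimal representations of $\{X_t\}$ are conjugate.
   Context: All statements about measure spaces (equalities, bijections, group-action identities) are understood modulo null sets. **S$\alpha$S fields.** A real random variable is S$\alpha$S with scale $\sigma\ge 0$ if its characteristic function is $\theta\mapsto \exp(-\sigma^\alpha|\theta|^\alpha)$. A collection $\{X_t\}_{t\in G}$ of real random variables is an S$\alpha$S random field if every finite real linear combination $\sum_i c_iX_{t_i}$ is S$\alpha$S and each $X_t$ has scale $>0$. It is (left-)stationary if $\{X_{st}\}_{t\in G}$ and $\{X_t\}_{t\in G}$ have the same finite-dimensional distributions for every $s\in G$. **Nonsingular actions.** A nonsingular $G$-action on a $\sigma$-finite standard measure space $(S,\mathcal S,\mu)$ is a family of measurable maps $\phi_t:S\to S$ with $\phi_e=\mathrm{id}$, $\phi_{uv}=\phi_v\circ\phi_u$ and $\mu\circ\phi_t\sim\mu$ for all $t$. A $\pm1$-valued cocycle for it is a family of measurable maps $c_t:S\to\{+1,-1\}$ with $c_{t_1t_2}(s)=c_{t_1}(s)\,c_{t_2}(\phi_{t_1}(s))$ for $\mu$-a.e. $s$. **Integral representations and minimality.** An integral representation of $\{X_t\}_{t\in G}$ is a family of real functions $\{f_t\}\subset L^\alpha(S,\mu)$ such that every $\sum_i c_iX_{t_i}$ is S$\alpha$S with scale $\left(\int_S|\sum_i c_if_{t_i}|^\alpha d\mu\right)^{1/\alpha}$; the full support condition $\bigcup_t\mathrm{Support}(f_t)=S$ is always assumed. It is minimal if for every $B\in\mathcal S$ there is $A\in\sigma\{f_t/f_u:t,u\in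 G\}$ with $\mu(A\Delta B)=0$. Here $f_t(s)/f_u(s)$ is defined to be $\infty$ when $f_t(s)\ge 0$, $f_u(s)=0$, and $-\infty$ when $f_t(s)<0$, $f_u(s)=0$ (so the $\sigma$-algebra is generated by extended real-valued functions). **Triplets.** $(f,\{\phi_t\},\{c_t\})$ is a Rosiński triplet of $\{X_t\}$ on $(S,\mu)$ if $f\in L^\alpha(S,\mu)$ is real-valued, $\{\phi_t\}$ is a nonsingular $G$-action on $(S,\mu)$, $\{c_t\}$ is a $\pm1$-valued cocycle for it, and $$f_t(s)=c_t(s)\left(\frac{d\mu\circ\phi_t}{d\mu}(s)\right)^{1/\alpha}f\circ\phi_t(s),\qquad t\in G,$$ is an integral representation of $\{X_t\}$. The triplet is minimal if this representation is minimal; $\{\phi_t\}$ is then said to be the action arising in that minimal representation. **Conjugacy.** Nonsingular $G$-actions $\{\phi^{(i)}_t\}_{t\in G}$ on $(S_i,\mu_i)$, $i=1,2$, are conjugate via $h$ if $h:S_1\to S_2$ is a bijection with $h,h^{-1}$ measurable, $\mu_1\circ h^{-1}\sim\mu_2$, and $h\circ\phi^{(1)}_t=\phi^{(2)}_t\circ h$ for all $t\in G$. **The relation $\approx$.** For nonsingular $G$-actions $\{\phi^{(i)}_t\}$ on $(S_i,\mu_i)$ with $\pm1$-valued cocycles $\{c^{(i)}_t\}$, $i=1,2$, write $(\{\phi^{(1)}_t\},\{c^{(1)}_t\})\approx(\{\phi^{(2)}_t\},\{c^{(2)}_t\})$ if the actions are conjugate via some $h:S_1\to S_2$ and there is a measurable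 $b:S_2\to\{+1,-1\}$ such that for each $t\in G$, $c^{(1)}_t\circ h^{-1}(s)=c^{(2)}_t(s)\,\dfrac{b\circ\phi^{(2)}_t(s)}{b(s)}$ for $\mu_2$-a.e. $s\in S_2$.
   Formalization: In the definition of minimality, the ratio f_t/f_u is set to ∞ wherever f_u=0, whatever the sign of f_t (instead of −∞ when f_t<0); with the signed convention (b) and the "Moreover" of (a) are false. *)

theory Defs
  imports "HOL-Probability.Probability" "HOL-Algebra.Group"
begin

section \<open>Symmetric stable random fields\<close>

definition sas_rv :: "real \<Rightarrow> 'w measure \<Rightarrow> ('w \<Rightarrow> real) \<Rightarrow> real \<Rightarrow> bool" where
  "sas_rv \<alpha> P Y \<sigma> \<longleftrightarrow>
     Y \<in> borel_measurable P \<and> \<sigma> \<ge> 0 \<and>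
     (\<forall>\<theta>. char (distr P borel Y) \<theta> =
        complex_of_real (exp (- ((\<sigma> powr \<alpha>) * (\<bar>\<theta>\<bar> powr \<alpha>)))))"

definition sas_field ::
  "real \<Rightarrow> ('g, 'm) monoid_scheme \<Rightarrow> 'w measure \<Rightarrow> ('g \<Rightarrow> 'w \<Rightarrow> real) \<Rightarrow> bool" where
  "sas_field \<alpha> G P X \<longleftrightarrow>
     (\<forall>F a. finite F \<and> F \<subseteq> carrier G \<longrightarrow>
        (\<exists>\<sigma>. sas_rv \<alpha> P (\<lambda>\<omega>. \<Sum>t\<in>F. a t * X t \<omega>) \<sigma>)) \<and>
     (\<forall>t\<in>carrier G. \<exists>\<sigma>>0. sas_rv \<alpha> P (X t) \<sigma>)"

definition stationary_field ::
  "('g, 'm) monoid_scheme \<Rightarrow> 'w measure \<Rightarrow> ('g \<Rightarrow> 'w \<Rightarrow> real) \<Rightarrow> bool" where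
  "stationary_field G P X \<longleftrightarrow>
     (\<forall>s\<in>carrier G. \<forall>F. finite F \<and> F \<subseteq> carrier G \<longrightarrow>
        distr P (Pi\<^sub>M F (\<lambda>_. borel)) (\<lambda>\<omega>. \<lambda>t\<in>F. X (s \<otimes>\<^bsub>G\<^esub> t) \<omega>) =
        distr P (Pi\<^sub>M F (\<lambda>_. borel)) (\<lambda>\<omega>. \<lambda>t\<in>F. X t \<omega>))"

section \<open>Nonsingular actions and cocycles\<close>

definition standard_measure_space :: "'a measure \<Rightarrow> bool" where
  "standard_measure_space M \<longleftrightarrow>
     sigma_finite_measure M \<and>
     (\<exists>T. completely_metrizable_space T \<and> second_countable T \<and>
          topspace T = space M \<and> sets M = sigma_sets (space M) {U. openin T U})"

definition equiv_measure :: "'a measure \<Rightarrow> 'a measure \<Rightarrow> bool" where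
  "equiv_measure M N \<longleftrightarrow>
     sets M = sets N \<and> absolutely_continuous M N \<and> absolutely_continuous N M"

text \<open>
  The group identities of an action hold only modulo null sets, so the image of a measurable set
  under \<open>\<phi> t\<close> need not be measurable. The measure \<open>A \<mapsto> \<mu> (\<phi>\<^sub>t A)\<close> is therefore taken to be
  the push-forward of \<open>\<mu>\<close> under \<open>\<phi>\<close> at the inverse of \<open>t\<close>, which is the inverse of \<open>\<phi> t\<close>
  (modulo null sets); for a strict action the two agree on every measurable set.
\<close>

definition translated_measure ::
  "('g, 'm) monoid_scheme \<Rightarrow> 'a measure \<Rightarrow> ('g \<Rightarrow> 'a \<Rightarrow> 'a) \<Rightarrow> 'g \<Rightarrow> 'a measure" where
  "translated_measure G M \<phi> t = distr M M (\<phi> (inv\<^bsub>G\<^esub> t))"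

definition nonsingular_action ::
  "('g, 'm) monoid_scheme \<Rightarrow> 'a measure \<Rightarrow> ('g \<Rightarrow> 'a \<Rightarrow> 'a) \<Rightarrow> bool" where
  "nonsingular_action G M \<phi> \<longleftrightarrow>
     standard_measure_space M \<and>
     (\<forall>t\<in>carrier G. \<phi> t \<in> M \<rightarrow>\<^sub>M M) \<and>
     (AE s in M. \<phi> \<one>\<^bsub>G\<^esub> s = s) \<and>
     (\<forall>u\<in>carrier G. \<forall>v\<in>carrier G. AE s in M. \<phi> (u \<otimes>\<^bsub>G\<^esub> v) s = \<phi> v (\<phi> u s)) \<and>
     (\<forall>t\<in>carrier G. equiv_measure (translated_measure G M \<phi> t) M)"

definition sign_map :: "'a measure \<Rightarrow> ('a \<Rightarrow> real) \<Rightarrow> bool" where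
  "sign_map M b \<longleftrightarrow> b \<in> borel_measurable M \<and> (\<forall>s\<in>space M. b s \<in> {1, -1})"

definition sign_cocycle ::
  "('g, 'm) monoid_scheme \<Rightarrow> 'a measure \<Rightarrow> ('g \<Rightarrow> 'a \<Rightarrow> 'a) \<Rightarrow> ('g \<Rightarrow> 'a \<Rightarrow> real) \<Rightarrow> bool" where
  "sign_cocycle G M \<phi> c \<longleftrightarrow>
     (\<forall>t\<in>carrier G. sign_map M (c t)) \<and>
     (\<forall>t\<^sub>1\<in>carrier G. \<forall>t\<^sub>2\<in>carrier G.
        AE s in M. c (t\<^sub>1 \<otimes>\<^bsub>G\<^esub> t\<^sub>2) s = c t\<^sub>1 s * c t\<^sub>2 (\<phi> t\<^sub>1 s))"

section \<open>Integral representations and minimality\<close>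

definition in_Lalpha :: "real \<Rightarrow> 'a measure \<Rightarrow> ('a \<Rightarrow> real) \<Rightarrow> bool" where
  "in_Lalpha \<alpha> M f \<longleftrightarrow> f \<in> borel_measurable M \<and> integrable M (\<lambda>s. \<bar>f s\<bar> powr \<alpha>)"

definition integral_representation ::
  "real \<Rightarrow> ('g, 'm) monoid_scheme \<Rightarrow> 'w measure \<Rightarrow> ('g \<Rightarrow> 'w \<Rightarrow> real) \<Rightarrow>
   'a measure \<Rightarrow> ('g \<Rightarrow> 'a \<Rightarrow> real) \<Rightarrow> bool" where
  "integral_representation \<alpha> G P X M ft \<longleftrightarrow>
     (\<forall>t\<in>carrier G. in_Lalpha \<alpha> M (ft t)) \<and>
     (\<forall>F a. finite F \<and> F \<subseteq> carrier G \<longrightarrow>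
        sas_rv \<alpha> P (\<lambda>\<omega>. \<Sum>t\<in>F. a t * X t \<omega>)
          ((LINT s|M. \<bar>\<Sum>t\<in>F. a t * ft t s\<bar> powr \<alpha>) powr (1 / \<alpha>))) \<and>
     (AE s in M. \<exists>t\<in>carrier G. ft t s \<noteq> 0)"

text \<open>
  A ratio with denominator zero is \<open>\<infinity>\<close>, whatever the sign of the numerator. Some authors use
  \<open>- \<infinity>\<close> for a negative numerator instead. With that convention minimality is not invariant
  under multiplying all \<open>f\<^sub>t\<close> by a common \<open>\<plusminus>1\<close>-valued function, and uniqueness of
  minimal representations fails: let \<open>G = {e, a}\<close> have order two and let \<open>G\<close> act by translation on
  \<open>S\<^sub>1 = G \<times> {1, -1}\<close> (counting measure, first coordinate) and on \<open>S\<^sub>2 = G\<close>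
  (twice the counting measure), with trivial cocycles. The functions \<open>f(g, \<epsilon>) = \<epsilon> 1{g = e}\<close>
  and \<open>f(g) = 1{g = e}\<close> represent the same field of two independent variables. The signed ratios
  separate the four points of \<open>S\<^sub>1\<close> as well as the two points of \<open>S\<^sub>2\<close>,
  but the two actions are not conjugate.
\<close>

definition ext_ratio :: "real \<Rightarrow> real \<Rightarrow> ereal" where
  "ext_ratio x y = (if y = 0 then \<infinity> else ereal (x / y))"

definition ratio_algebra ::
  "('g, 'm) monoid_scheme \<Rightarrow> 'a measure \<Rightarrow> ('g \<Rightarrow> 'a \<Rightarrow> real) \<Rightarrow> 'a set set" where
  "ratio_algebra G M ft =
     sigma_sets (space M)
       {(\<lambda>s. ext_ratio (ft t s) (ft u s)) -` E \<inter> space M | t u E.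
          t \<in> carrier G \<and> u \<in> carrier G \<and> E \<in> sets borel}"

definition minimal_family ::
  "('g, 'm) monoid_scheme \<Rightarrow> 'a measure \<Rightarrow> ('g \<Rightarrow> 'a \<Rightarrow> real) \<Rightarrow> bool" where
  "minimal_family G M ft \<longleftrightarrow>
     (\<forall>B\<in>sets M. \<exists>A\<in>ratio_algebra G M ft. (A - B) \<union> (B - A) \<in> null_sets M)"

section \<open>Triplets\<close>

definition triplet_family ::
  "real \<Rightarrow> ('g, 'm) monoid_scheme \<Rightarrow> 'a measure \<Rightarrow>
   ('a \<Rightarrow> real) \<Rightarrow> ('g \<Rightarrow> 'a \<Rightarrow> 'a) \<Rightarrow> ('g \<Rightarrow> 'a \<Rightarrow> real) \<Rightarrow> 'g \<Rightarrow> 'a \<Rightarrow> real" where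
  "triplet_family \<alpha> G M f \<phi> c t s =
     c t s * enn2real (RN_deriv M (translated_measure G M \<phi> t) s) powr (1 / \<alpha>) * f (\<phi> t s)"

definition rosinski_triplet ::
  "real \<Rightarrow> ('g, 'm) monoid_scheme \<Rightarrow> 'w measure \<Rightarrow> ('g \<Rightarrow> 'w \<Rightarrow> real) \<Rightarrow> 'a measure \<Rightarrow>
   ('a \<Rightarrow> real) \<Rightarrow> ('g \<Rightarrow> 'a \<Rightarrow> 'a) \<Rightarrow> ('g \<Rightarrow> 'a \<Rightarrow> real) \<Rightarrow> bool" where
  "rosinski_triplet \<alpha> G P X M f \<phi> c \<longleftrightarrow>
     in_Lalpha \<alpha> M f \<and> nonsingular_action G M \<phi> \<and> sign_cocycle G M \<phi> c \<and>
     integral_representation \<alpha> G P X M (triplet_family \<alpha> G M f \<phi> c)"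

definition minimal_triplet ::
  "real \<Rightarrow> ('g, 'm) monoid_scheme \<Rightarrow> 'w measure \<Rightarrow> ('g \<Rightarrow> 'w \<Rightarrow> real) \<Rightarrow> 'a measure \<Rightarrow>
   ('a \<Rightarrow> real) \<Rightarrow> ('g \<Rightarrow> 'a \<Rightarrow> 'a) \<Rightarrow> ('g \<Rightarrow> 'a \<Rightarrow> real) \<Rightarrow> bool" where
  "minimal_triplet \<alpha> G P X M f \<phi> c \<longleftrightarrow>
     rosinski_triplet \<alpha> G P X M f \<phi> c \<and> minimal_family G M (triplet_family \<alpha> G M f \<phi> c)"

section \<open>Conjugacy\<close>

text \<open>
  A bijection modulo null sets with measurable inverse is given by two measurable maps \<open>h\<close> and
  \<open>h'\<close> that are inverse to each other almost everywhere; \<open>h'\<close> is what is written \<open>h\<^sup>-\<^sup>1\<close>.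
\<close>

definition conjugate_via ::
  "('g, 'm) monoid_scheme \<Rightarrow> 'a measure \<Rightarrow> ('g \<Rightarrow> 'a \<Rightarrow> 'a) \<Rightarrow> 'b measure \<Rightarrow> ('g \<Rightarrow> 'b \<Rightarrow> 'b) \<Rightarrow>
   ('a \<Rightarrow> 'b) \<Rightarrow> ('b \<Rightarrow> 'a) \<Rightarrow> bool" where
  "conjugate_via G M\<^sub>1 \<phi>\<^sub>1 M\<^sub>2 \<phi>\<^sub>2 h h' \<longleftrightarrow>
     h \<in> M\<^sub>1 \<rightarrow>\<^sub>M M\<^sub>2 \<and> h' \<in> M\<^sub>2 \<rightarrow>\<^sub>M M\<^sub>1 \<and>
     (AE s in M\<^sub>1. h' (h s) = s) \<and> (AE s in M\<^sub>2. h (h' s) = s) \<and>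
     equiv_measure (distr M\<^sub>1 M\<^sub>2 h) M\<^sub>2 \<and>
     (\<forall>t\<in>carrier G. AE s in M\<^sub>1. h (\<phi>\<^sub>1 t s) = \<phi>\<^sub>2 t (h s))"

definition conjugate ::
  "('g, 'm) monoid_scheme \<Rightarrow> 'a measure \<Rightarrow> ('g \<Rightarrow> 'a \<Rightarrow> 'a) \<Rightarrow> 'b measure \<Rightarrow> ('g \<Rightarrow> 'b \<Rightarrow> 'b) \<Rightarrow>
   bool" where
  "conjugate G M\<^sub>1 \<phi>\<^sub>1 M\<^sub>2 \<phi>\<^sub>2 \<longleftrightarrow> (\<exists>h h'. conjugate_via G M\<^sub>1 \<phi>\<^sub>1 M\<^sub>2 \<phi>\<^sub>2 h h')"

definition approx_via ::
  "('g, 'm) monoid_scheme \<Rightarrow>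
   'a measure \<Rightarrow> ('g \<Rightarrow> 'a \<Rightarrow> 'a) \<Rightarrow> ('g \<Rightarrow> 'a \<Rightarrow> real) \<Rightarrow>
   'b measure \<Rightarrow> ('g \<Rightarrow> 'b \<Rightarrow> 'b) \<Rightarrow> ('g \<Rightarrow> 'b \<Rightarrow> real) \<Rightarrow>
   ('a \<Rightarrow> 'b) \<Rightarrow> ('b \<Rightarrow> 'a) \<Rightarrow> ('b \<Rightarrow> real) \<Rightarrow> bool" where
  "approx_via G M\<^sub>1 \<phi>\<^sub>1 c\<^sub>1 M\<^sub>2 \<phi>\<^sub>2 c\<^sub>2 h h' b \<longleftrightarrow>
     conjugate_via G M\<^sub>1 \<phi>\<^sub>1 M\<^sub>2 \<phi>\<^sub>2 h h' \<and> sign_map M\<^sub>2 b \<and>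
     (\<forall>t\<in>carrier G. AE s in M\<^sub>2. c\<^sub>1 t (h' s) = c\<^sub>2 t s * (b (\<phi>\<^sub>2 t s) / b s))"

definition approx ::
  "('g, 'm) monoid_scheme \<Rightarrow>
   'a measure \<Rightarrow> ('g \<Rightarrow> 'a \<Rightarrow> 'a) \<Rightarrow> ('g \<Rightarrow> 'a \<Rightarrow> real) \<Rightarrow>
   'b measure \<Rightarrow> ('g \<Rightarrow> 'b \<Rightarrow> 'b) \<Rightarrow> ('g \<Rightarrow> 'b \<Rightarrow> real) \<Rightarrow> bool" where
  "approx G M\<^sub>1 \<phi>\<^sub>1 c\<^sub>1 M\<^sub>2 \<phi>\<^sub>2 c\<^sub>2 \<longleftrightarrow>
     (\<exists>h h' b. approx_via G M\<^sub>1 \<phi>\<^sub>1 c\<^sub>1 M\<^sub>2 \<phi>\<^sub>2 c\<^sub>2 h h' b)"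

definition transported_function ::
  "real \<Rightarrow> 'a measure \<Rightarrow> 'b measure \<Rightarrow> ('a \<Rightarrow> real) \<Rightarrow>
   ('a \<Rightarrow> 'b) \<Rightarrow> ('b \<Rightarrow> 'a) \<Rightarrow> ('b \<Rightarrow> real) \<Rightarrow> 'b \<Rightarrow> real" where
  "transported_function \<alpha> M\<^sub>1 M\<^sub>2 f h h' b s =
     b s * enn2real (RN_deriv M\<^sub>2 (distr M\<^sub>1 M\<^sub>2 h) s) powr (1 / \<alpha>) * f (h' s)"

end

theory Submission
  imports Defs
begin

text \<open>
  The scales of the linear combinations determine \<open>\<integral>\<bar>\<Sum> a\<^sub>t f\<^sub>t\<bar>\<^sup>\<alpha> d\<mu>\<close>, up to a constant the integral of
  \<open>1 - cos (r \<Sum> a\<^sub>t f\<^sub>t)\<close> against \<open>\<bar>r\<bar>\<^sup>-\<^sup>1\<^sup>-\<^sup>\<alpha> dr \<otimes> \<mu>\<close>. Weighting with \<open>1 - cos (r f\<^sub>u)\<close>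
  makes the image of the latter measure under \<open>(r f\<^sub>t)\<^sub>t\<close> finite, with Fourier transform determined by
  the scales. Removing the weight and the radial variable, the law of
  the direction \<open>U = (f\<^sub>t / k)\<^sub>t\<close>, with \<open>k\<close> the first nonvanishing \<open>f\<^sub>t\<close>, under \<open>\<bar>k\<bar>\<^sup>\<alpha> \<mu>\<close>
  depends on the field only.

  Minimality says that \<open>U\<close> generates the \<open>\<sigma>\<close>-algebra modulo null sets, so that on a standard space
  \<open>U\<close> is invertible modulo null sets; hence \<open>h = U\<^sub>2\<^sup>-\<^sup>1 \<circ> U\<^sub>1\<close> is an isomorphism modulo null sets. Since
  \<open>f\<^sub>t\<^sub>v = c\<^sub>t w\<^sub>t\<^sup>1\<^sup>/\<^sup>\<alpha> (f\<^sub>v \<circ> \<phi>\<^sub>t)\<close>, the map \<open>U\<close> intertwines \<open>\<phi>\<^sub>t\<close> with a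
  transformation that does not depend on the representation, and \<open>c\<^sub>t\<close> is a coboundary of the sign of \<open>k\<close> up to a
  function of \<open>U\<close>. Transport of a triplet along a given conjugacy is a computation with
  Radon--Nikodym derivatives.
\<close>

section \<open>Uniqueness of finite-dimensional laws\<close>

text \<open>The phases \<open>c = 0\<close> and \<open>c = - pi/2\<close> give the real and
  imaginary parts of the Fourier transform, and \<open>a = c = 0\<close> gives the total mass.
  Levy's uniqueness theorem then applies once both images are normalised to probability
  measures.\<close>

lemma cos_integrals_determine_distr:
  fixes X :: "'a \<Rightarrow> real" and Y :: "'b \<Rightarrow> real"
  assumes "finite_measure M" "finite_measure N"
    and [measurable]: "X \<in> borel_measurable M" "Y \<in> borel_measurable N"
    and eq: "\<And>a c. (LINT s|M. cos (c + a * X s)) = (LINT s|N. cos (c + a * Y s))"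
  shows "distr M borel X = distr N borel Y"
proof -
  interpret M: finite_measure M by fact
  interpret N: finite_measure N by fact
  define m where "m = measure M (space M)"
  have m: "m = measure N (space N)"
    using eq[of 0 0] by (simp add: m_def)
  show ?thesis
  \<comment> \<open>Total mass zero cannot be normalised; in that case both images vanish.\<close>
  proof (cases "m = 0")
    case True
    have "emeasure (distr M borel X) A = emeasure (distr N borel Y) A" if [measurable]: "A \<in> sets borel" for A
    proof -
      have "emeasure M (X -` A \<inter> space M) \<le> emeasure M (space M)" by (rule emeasure_mono) auto
      moreover have "emeasure N (Y -` A \<inter> space N) \<le> emeasure N (space N)" by (rule emeasure_mono) auto
      ultimately show ?thesis using True m
        by (simp add: emeasure_distr m_def M.emeasure_eq_measure N.emeasure_eq_measure measure_le_0_iff)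
    qed
    then show ?thesis by (intro measure_eqI) auto
  next
    case False
    then have mpos: "m > 0" unfolding m_def using measure_nonneg[of M "space M"] by linarith
    define C where "C K = scale_measure (ennreal (1 / m)) K" for K :: "real measure"
    have C: "real_distribution (C (distr M borel X))" "real_distribution (C (distr N borel Y))"
      using mpos m
      by (auto intro!: real_distribution.intro real_distribution_axioms.intro prob_spaceI
          simp: C_def space_scale_measure emeasure_distr M.emeasure_eq_measure N.emeasure_eq_measure
           m_def[symmetric] ennreal_mult[symmetric])
    have "char (C (distr M borel X)) = char (C (distr N borel Y))"
    proof
      fix t
      have ch: "char (C (distr K borel Z)) t
         = (1/m) * (Complex (LINT s|K. cos (0 + t * Z s)) (LINT s|K. cos (- pi/2 + t * Z s)))"
        if "finite_measure K" and [measurable]: "Z \<in> borel_measurable K" for K :: "'c measure" and Z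
      proof -
        interpret K: finite_measure K by fact
        have i: "integrable K (\<lambda>s. cos (c + t * Z s))" for c
          by (rule K.integrable_const_bound[of _ 1]) auto
        have "C (distr K borel Z) = density (distr K borel Z) (\<lambda>_. ennreal (1/m))"
          unfolding C_def by (rule measure_eqI) (auto simp: emeasure_density nn_integral_cmult_indicator)
        then have "char (C (distr K borel Z)) t = (1/m) * (CLINT s|K. iexp (t * Z s))"
          using mpos by (simp add: char_def integral_density integral_distr scaleR_conv_of_real)
        also have "(CLINT s|K. iexp (t * Z s)) = Complex (LINT s|K. cos (0 + t * Z s)) (LINT s|K. cos (- pi/2 + t * Z s))"
        proof -
          have i: "integrable K (\<lambda>s. iexp (t * Z s))"
            by (rule K.integrable_const_bound[of _ 1]) auto
          show ?thesis
            using integral_bounded_linear[OF bounded_linear_Re i] integral_bounded_linear[OF bounded_linear_Im i]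
            by (auto intro!: complex_eqI simp: Re_exp Im_exp cos_diff)
        qed
        finally show ?thesis .
      qed
      show "char (C (distr M borel X)) t = char (C (distr N borel Y)) t"
        by (simp only: ch[OF assms(1,3)] ch[OF assms(2,4)] eq)
    qed
    from Levy_uniqueness[OF C this] have e: "C (distr M borel X) = C (distr N borel Y)" .
    have "emeasure (distr M borel X) A = emeasure (distr N borel Y) A" if "A \<in> sets borel" for A
    proof -
      have "ennreal m * (ennreal (1/m) * emeasure (distr M borel X) A) = ennreal m * (ennreal (1/m) * emeasure (distr N borel Y) A)"
        using arg_cong[OF e, of "\<lambda>K. emeasure K A"] by (simp add: C_def)
      moreover have "ennreal m * ennreal (1/m) = 1" using mpos by (simp add: ennreal_mult[symmetric])
      ultimately show ?thesis by (simp add: mult.assoc[symmetric])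
    qed
    then show ?thesis by (intro measure_eqI) auto
  qed
qed

lemma finite_measure_density_bounded:
  fixes w :: "'a \<Rightarrow> real"
  assumes "finite_measure M" and [measurable]: "w \<in> borel_measurable M"
    and w: "\<And>s. 0 \<le> w s" "\<And>s. w s \<le> B"
  shows "finite_measure (density M (\<lambda>s. ennreal (w s)))"
proof -
  interpret finite_measure M by fact
  have "emeasure (density M (\<lambda>s. ennreal (w s))) (space M) \<le> (\<integral>\<^sup>+s. ennreal B \<partial>M)"
    by (subst emeasure_density) (auto intro!: nn_integral_mono ennreal_leI w simp del: nn_integral_const)
  also have "\<dots> < \<infinity>" by (simp add: ennreal_mult_less_top emeasure_eq_measure)
  finally show ?thesis by (intro finite_measureI) auto
qed

text \<open>Conditioning on the coordinates one at a time: weighting by the nonnegative function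
  \<open>1 + cos (d + \<dots>)\<close> of the other coordinates reduces the uniqueness theorem to dimension one.\<close>

lemma cos_integrals_determine_joint_law:
  fixes x :: "'i \<Rightarrow> 'a \<Rightarrow> real" and y :: "'i \<Rightarrow> 'b \<Rightarrow> real"
  assumes "finite F" "finite_measure M" "finite_measure N"
    and "\<And>i. i \<in> F \<Longrightarrow> x i \<in> borel_measurable M" "\<And>i. i \<in> F \<Longrightarrow> y i \<in> borel_measurable N"
    and "\<And>a c. (LINT s|M. cos (c + (\<Sum>i\<in>F. a i * x i s))) = (LINT s|N. cos (c + (\<Sum>i\<in>F. a i * y i s)))"
    and "\<And>i. i \<in> F \<Longrightarrow> A i \<in> sets borel"
  shows "measure M {s \<in> space M. \<forall>i\<in>F. x i s \<in> A i} = measure N {s \<in> space N. \<forall>i\<in>F. y i s \<in> A i}"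
  using assms
proof (induction F arbitrary: M N rule: finite_induct)
  case empty
  from empty(5)[of 0] show ?case by simp
next
  case (insert v F)
  interpret M: finite_measure M by fact
  interpret N: finite_measure N by fact
  have [simp]: "0 \<le> 1 + cos r" "1 + cos r \<le> 2" for r :: real
    using cos_ge_minus_one[of r] cos_le_one[of r] by linarith+
  note [measurable] = insert.prems(3)[of v, simplified] insert.prems(4)[of v, simplified]
  have [measurable]: "A v \<in> sets borel" using insert.prems by simp
  have mx[measurable]: "i \<in> F \<Longrightarrow> x i \<in> borel_measurable M"
   and my[measurable]: "i \<in> F \<Longrightarrow> y i \<in> borel_measurable N" for i
    using insert.prems by auto
  have iM: "integrable M (\<lambda>s. cos (f s))" if [measurable]: "f \<in> borel_measurable M" for f :: "'a \<Rightarrow> real"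
    by (rule M.integrable_const_bound[of _ 1]) auto
  have iN: "integrable N (\<lambda>s. cos (f s))" if [measurable]: "f \<in> borel_measurable N" for f :: "'b \<Rightarrow> real"
    by (rule N.integrable_const_bound[of _ 1]) auto
  have sumv: "(LINT s|M. cos (c + a * x v s + (\<Sum>i\<in>F. b i * x i s))) = (LINT s|N. cos (c + a * y v s + (\<Sum>i\<in>F. b i * y i s)))" for c a b
  proof -
    have "(\<Sum>i\<in>F. (if i = v then a else b i) * z i) = (\<Sum>i\<in>F. b i * z i)" for z :: "'i \<Rightarrow> real"
      using insert.hyps by (intro sum.cong) auto
    then show ?thesis
      using insert.prems(5)[of c "\<lambda>i. if i = v then a else b i"] insert.hyps by (simp add: add.assoc)
  qed
  have "distr (density M (\<lambda>s. ennreal (1 + cos (d + (\<Sum>i\<in>F. b i * x i s))))) borel (x v)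
      = distr (density N (\<lambda>s. ennreal (1 + cos (d + (\<Sum>i\<in>F. b i * y i s))))) borel (y v)" (is "?L = ?R") for d b
  proof (rule cos_integrals_determine_distr)
    \<comment> \<open>Product-to-sum: the weighted integrand becomes a sum of three cosines of
      linear combinations, to which the hypothesis applies.\<close>
    have t: "(1 + cos B) * cos A = cos A + (1/2) * cos (A + B) + (1/2) * cos (A - B)" for A B :: real
      by (simp add: cos_add cos_diff algebra_simps)
    fix a c
    let ?S = "\<lambda>s. \<Sum>i\<in>F. b i * x i s" and ?T = "\<lambda>s. \<Sum>i\<in>F. b i * y i s"
    have mi: "A + - (\<Sum>i\<in>F. b i * z i) = A + (\<Sum>i\<in>F. - b i * z i)" for z :: "'i \<Rightarrow> real" and A
      by (simp add: sum_negf)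
    have "(LINT s|density M (\<lambda>s. ennreal (1 + cos (d + ?S s))). cos (c + a * x v s))
       = (LINT s|M. (1 + cos (d + ?S s)) * cos (c + a * x v s))"
      by (subst integral_density) auto
    also have "\<dots> = (LINT s|M. cos (c + a * x v s + (\<Sum>i\<in>F. 0 * x i s)) + (1/2) * cos ((c + d) + a * x v s + (\<Sum>i\<in>F. b i * x i s))
         + (1/2) * cos ((c - d) + a * x v s + (\<Sum>i\<in>F. - b i * x i s)))"
      by (intro Bochner_Integration.integral_cong refl, subst t) (simp add: sum_negf algebra_simps)
    also have "\<dots> = (LINT s|N. cos (c + a * y v s + (\<Sum>i\<in>F. 0 * y i s)) + (1/2) * cos ((c + d) + a * y v s + (\<Sum>i\<in>F. b i * y i s))
         + (1/2) * cos ((c - d) + a * y v s + (\<Sum>i\<in>F. - b i * y i s)))"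
      using sumv[of c a "\<lambda>_. 0"] sumv[of "c - d" a "\<lambda>i. - b i"]
      by (simp add: iM iN Bochner_Integration.integral_add sumv)
    also have "\<dots> = (LINT s|N. (1 + cos (d + ?T s)) * cos (c + a * y v s))"
      by (intro Bochner_Integration.integral_cong refl, subst t) (simp add: sum_negf algebra_simps)
    also have "\<dots> = (LINT s|density N (\<lambda>s. ennreal (1 + cos (d + ?T s))). cos (c + a * y v s))"
      by (subst integral_density) auto
    finally show "(LINT s|density M (\<lambda>s. ennreal (1 + cos (d + ?S s))). cos (c + a * x v s)) = (LINT s|density N (\<lambda>s. ennreal (1 + cos (d + ?T s))). cos (c + a * y v s))" .
  next
    show "finite_measure (density M (\<lambda>s. ennreal (1 + cos (d + (\<Sum>i\<in>F. b i * x i s)))))"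
      by (intro finite_measure_density_bounded[where B=2] insert.prems) auto
    show "finite_measure (density N (\<lambda>s. ennreal (1 + cos (d + (\<Sum>i\<in>F. b i * y i s)))))"
      by (intro finite_measure_density_bounded[where B=2] insert.prems) auto
  qed auto
  note distr_eq = this
  have w: "(LINT s|M. (1 + cos (d + (\<Sum>i\<in>F. b i * x i s))) * indicator (A v) (x v s))
     = (LINT s|N. (1 + cos (d + (\<Sum>i\<in>F. b i * y i s))) * indicator (A v) (y v s))" for d b
  proof -
    have aux: "(LINT s|K. W s * indicator (A v) (Z s)) = (LINT z|distr (density K (\<lambda>s. ennreal (W s))) borel Z. indicator (A v) z :: real)"
      if [measurable]: "W \<in> borel_measurable K" "Z \<in> borel_measurable K" and "\<And>s. 0 \<le> W s"
      for K :: "'c measure" and W Z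
    proof -
      have "(LINT z|distr (density K (\<lambda>s. ennreal (W s))) borel Z. indicator (A v) z :: real)
         = (LINT s|density K (\<lambda>s. ennreal (W s)). indicator (A v) (Z s))"
        by (rule integral_distr) auto
      also have "\<dots> = (LINT s|K. W s *\<^sub>R indicator (A v) (Z s))"
        using that by (intro integral_density) auto
      finally show ?thesis by simp
    qed
    show ?thesis
      by (subst (1 2) aux) (auto simp only: distr_eq, auto)
  qed
  have iMA: "integrable M (\<lambda>s. cos (f s) * indicator (A v) (x v s))" if [measurable]: "f \<in> borel_measurable M" for f :: "'a \<Rightarrow> real"
    by (rule M.integrable_const_bound[of _ 1]) (auto split: split_indicator)
  have iNA: "integrable N (\<lambda>s. cos (f s) * indicator (A v) (y v s))" if [measurable]: "f \<in> borel_measurable N" for f :: "'b \<Rightarrow> real"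
    by (rule N.integrable_const_bound[of _ 1]) (auto split: split_indicator)
  \<comment> \<open>With \<open>d = 0\<close> and \<open>b = 0\<close> the weight is the constant 2.
    This isolates the unweighted term, which is subtracted in \<open>w2\<close>.\<close>
  have w1: "(LINT s|M. indicator (A v) (x v s)) = (LINT s|N. indicator (A v) (y v s) :: real)"
    using w[of 0 "\<lambda>_. 0"] by simp
  have iM1: "integrable M (\<lambda>s. indicator (A v) (x v s) :: real)"
    using iMA[of "\<lambda>_. 0"] by simp
  have iN1: "integrable N (\<lambda>s. indicator (A v) (y v s) :: real)"
    using iNA[of "\<lambda>_. 0"] by simp
  have w2: "(LINT s|M. indicator (A v) (x v s) * cos (d + (\<Sum>i\<in>F. b i * x i s)))
     = (LINT s|N. indicator (A v) (y v s) * cos (d + (\<Sum>i\<in>F. b i * y i s)))" for d b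
    using w[of d b] iM1 iN1 iMA iNA w1
    by (simp add: distrib_right Bochner_Integration.integral_add mult.commute[of "indicator _ _"])
  \<comment> \<open>Restricting to the event at coordinate \<open>v\<close> gives finite measures
    whose cosine integrals over the remaining coordinates agree by \<open>w2\<close>; this is why
    the induction runs over all \<open>M\<close> and \<open>N\<close>.\<close>
  define M' where "M' = density M (\<lambda>s. ennreal (indicator (A v) (x v s)))"
  define N' where "N' = density N (\<lambda>s. ennreal (indicator (A v) (y v s)))"
  have "measure M' {s \<in> space M'. \<forall>i\<in>F. x i s \<in> A i} = measure N' {s \<in> space N'. \<forall>i\<in>F. y i s \<in> A i}"
  proof (rule insert.IH)
    show "finite_measure M'" "finite_measure N'" unfolding M'_def N'_def
      by (intro finite_measure_density_bounded[where B=1] insert.prems; simp add: indicator_def)+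
    fix c a
    show "(LINT s|M'. cos (c + (\<Sum>i\<in>F. a i * x i s))) = (LINT s|N'. cos (c + (\<Sum>i\<in>F. a i * y i s)))"
      unfolding M'_def N'_def by (simp add: integral_density w2)
  qed (use insert.prems in \<open>auto simp: M'_def N'_def\<close>)
  moreover have "measure M' {s \<in> space M'. \<forall>i\<in>F. x i s \<in> A i} = measure M {s \<in> space M. \<forall>i\<in>insert v F. x i s \<in> A i}"
  proof -
    have [measurable]: "{s \<in> space M. \<forall>i\<in>F. x i s \<in> A i} \<in> sets M"
      using insert.prems insert.hyps by measurable
    have "emeasure M' {s \<in> space M'. \<forall>i\<in>F. x i s \<in> A i} = (\<integral>\<^sup>+s. indicator {s \<in> space M. \<forall>i\<in>insert v F. x i s \<in> A i} s \<partial>M)"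
      unfolding M'_def space_density
      by (subst emeasure_density, simp, simp, intro nn_integral_cong) (auto split: split_indicator)
    also have "\<dots> = emeasure M {s \<in> space M. \<forall>i\<in>insert v F. x i s \<in> A i}"
      using insert.prems insert.hyps by (subst nn_integral_indicator) auto
    finally show ?thesis by (simp add: measure_def)
  qed
  moreover have "measure N' {s \<in> space N'. \<forall>i\<in>F. y i s \<in> A i} = measure N {s \<in> space N. \<forall>i\<in>insert v F. y i s \<in> A i}"
  proof -
    have [measurable]: "{s \<in> space N. \<forall>i\<in>F. y i s \<in> A i} \<in> sets N"
      using insert.prems insert.hyps by measurable
    have "emeasure N' {s \<in> space N'. \<forall>i\<in>F. y i s \<in> A i} = (\<integral>\<^sup>+s. indicator {s \<in> space N. \<forall>i\<in>insert v F. y i s \<in> A i} s \<partial>N)"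
      unfolding N'_def space_density
      by (subst emeasure_density, simp, simp, intro nn_integral_cong) (auto split: split_indicator)
    also have "\<dots> = emeasure N {s \<in> space N. \<forall>i\<in>insert v F. y i s \<in> A i}"
      using insert.prems insert.hyps by (subst nn_integral_indicator) auto
    finally show ?thesis by (simp add: measure_def)
  qed
  ultimately show ?case by simp
qed

section \<open>Radial integrals and the Levy measure\<close>

lemma abs_add_powr_le:
  fixes x y p :: real
  assumes "0 \<le> p"
  shows "\<bar>x + y\<bar> powr p \<le> 2 powr p * (\<bar>x\<bar> powr p + \<bar>y\<bar> powr p)"
proof -
  \<comment> \<open>Bounding by twice the maximum avoids Minkowski's inequality, which fails for
    exponents below 1.\<close>
  have "\<bar>x + y\<bar> powr p \<le> (2 * max \<bar>x\<bar> \<bar>y\<bar>) powr p"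
    using assms by (intro powr_mono2) auto
  also have "\<dots> = 2 powr p * (max \<bar>x\<bar> \<bar>y\<bar>) powr p"
    by (simp add: powr_mult)
  also have "\<dots> \<le> 2 powr p * (\<bar>x\<bar> powr p + \<bar>y\<bar> powr p)"
    by (intro mult_left_mono) (auto simp: max_def)
  finally show ?thesis .
qed

lemma in_Lalpha_add:
  assumes "0 \<le> p" "in_Lalpha p M f" "in_Lalpha p M g"
  shows "in_Lalpha p M (\<lambda>s. f s + g s)"
proof -
  have [measurable]: "f \<in> borel_measurable M" "g \<in> borel_measurable M"
    and i: "integrable M (\<lambda>s. \<bar>f s\<bar> powr p)" "integrable M (\<lambda>s. \<bar>g s\<bar> powr p)"
    using assms by (auto simp: in_Lalpha_def)
  have "integrable M (\<lambda>s. \<bar>f s + g s\<bar> powr p)"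
    by (rule Bochner_Integration.integrable_bound[of _ "\<lambda>s. 2 powr p * (\<bar>f s\<bar> powr p + \<bar>g s\<bar> powr p)"])
       (use i abs_add_powr_le[OF assms(1)] in auto)
  then show ?thesis by (simp add: in_Lalpha_def)
qed

lemma in_Lalpha_cmult: "in_Lalpha p M f \<Longrightarrow> in_Lalpha p M (\<lambda>s. c * f s)"
  by (auto simp: in_Lalpha_def abs_mult powr_mult)

lemma in_Lalpha_sum:
  assumes "0 \<le> p" "\<And>i. i \<in> F \<Longrightarrow> in_Lalpha p M (f i)"
  shows "in_Lalpha p M (\<lambda>s. \<Sum>i\<in>F. a i * f i s)"
proof (cases "finite F")
  case True
  then show ?thesis using assms(2)
  proof (induction F)
    case empty
    then show ?case by (simp add: in_Lalpha_def)
  next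
    case (insert i F)
    have "in_Lalpha p M (\<lambda>s. a i * f i s + (\<Sum>i\<in>F. a i * f i s))"
      by (intro in_Lalpha_add in_Lalpha_cmult insert assms) auto
    with insert.hyps show ?case by simp
  qed
qed (simp add: in_Lalpha_def)

section \<open>The radial Levy density and its cosine integrals\<close>

definition levy_kernel :: "real \<Rightarrow> real \<Rightarrow> real" where
  "levy_kernel \<alpha> r = \<bar>r\<bar> powr (- 1 - \<alpha>)"

lemma levy_kernel_nonneg [simp]: "0 \<le> levy_kernel \<alpha> r"
  by (simp add: levy_kernel_def)

lemma levy_kernel_minus [simp]: "levy_kernel \<alpha> (- r) = levy_kernel \<alpha> r"
  by (simp add: levy_kernel_def)

lemma levy_kernel_mult: "levy_kernel \<alpha> (c * r) = \<bar>c\<bar> powr (- 1 - \<alpha>) * levy_kernel \<alpha> r"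
  by (simp add: levy_kernel_def abs_mult powr_mult)

lemma levy_kernel_measurable [measurable]: "levy_kernel \<alpha> \<in> borel_measurable borel"
  unfolding levy_kernel_def by measurable

lemma one_minus_cos_le: "1 - cos r \<le> r\<^sup>2 / (2::real)"
proof -
  have "1 - cos r = 2 * (sin (r/2))\<^sup>2"
    using cos_double_sin[of "r/2"] by simp
  also have "\<dots> \<le> 2 * (r/2)\<^sup>2"
    using abs_sin_le_one power_mono[OF abs_sin_x_le_abs_x[of "r/2"], of 2] by (simp add: power_divide)
  finally show ?thesis by (simp add: power2_eq_square)
qed

text \<open>For positive \<open>r\<close> the integrand is at most
  \<open>r powr (1 - \<alpha>)\<close> near 0, integrable because \<alpha> < 2, and at most
  \<open>2 * r powr (- 1 - \<alpha>)\<close> far out, integrable because \<alpha> > 0.\<close>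

lemma integrable_one_minus_cos_levy_kernel:
  assumes "0 < \<alpha>" "\<alpha> < 2"
  shows "integrable lborel (\<lambda>r. (1 - cos r) * levy_kernel \<alpha> r)"
proof -
  \<comment> \<open>The majorant on the positive half-line, zero for negative arguments;
    \<open>g r + g (- r)\<close> dominates on the whole line.\<close>
  define g where "g r = (indicator {0..1} r * r powr (1 - \<alpha>) + indicator {1..} r * (2 * r powr (- 1 - \<alpha>)))" for r :: real
  have "(\<integral>\<^sup>+r. ennreal (g r) \<partial>lborel) < \<infinity>"
  proof -
    have "(\<integral>\<^sup>+r. ennreal (g r) \<partial>lborel) = (\<integral>\<^sup>+r. ennreal (indicator {0..1} r * r powr (1 - \<alpha>)) \<partial>lborel)
       + (\<integral>\<^sup>+r. ennreal (2 * (indicator {1..} r * r powr (- 1 - \<alpha>))) \<partial>lborel)"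
      unfolding g_def by (subst nn_integral_add[symmetric]) (auto simp: ennreal_plus[symmetric] mult_ac simp del: ennreal_plus)
    also have "\<dots> < \<infinity>"
      using nn_integral_has_integral_lebesgue[OF _ has_integral_powr_from_0[of "1 - \<alpha>" 1]]
         nn_integral_has_integral_lebesgue[OF _ has_integral_powr_to_inf[of "- 1 - \<alpha>" 1]] assms
      by (simp add: ennreal_mult nn_integral_cmult ennreal_mult_less_top)
    finally show ?thesis .
  qed
  moreover have g0: "0 \<le> g r" for r by (simp add: g_def)
  moreover have [measurable]: "g \<in> borel_measurable borel" unfolding g_def by measurable
  ultimately have g: "integrable lborel g" by (intro integrableI_nonneg) auto
  then have "integrable lborel (\<lambda>r. g (- r))"
    using lborel_integrable_real_affine[OF g, of "-1" 0] by simp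
  with g have "integrable lborel (\<lambda>r. g r + g (- r))" by (rule Bochner_Integration.integrable_add)
  then show ?thesis
  proof (rule Bochner_Integration.integrable_bound)
    have k: "(1 - cos r) * levy_kernel \<alpha> r \<le> g r" if "0 \<le> r" for r
    proof (cases "r \<le> 1")
      case True
      show ?thesis
      proof (cases "r = 0")
        case True then show ?thesis using g0 by (simp add: levy_kernel_def)
      next
        case False
        then have "r > 0" using that by simp
        have "(1 - cos r) * levy_kernel \<alpha> r \<le> r\<^sup>2 * levy_kernel \<alpha> r"
          by (intro mult_right_mono order.trans[OF one_minus_cos_le]) auto
        also have "\<dots> = r powr (1 - \<alpha>)"
          using \<open>r > 0\<close> by (simp add: levy_kernel_def powr_numeral[symmetric] powr_add[symmetric] del: powr_numeral)
        also have "\<dots> \<le> g r" using True \<open>r > 0\<close> by (simp add: g_def)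
        finally show ?thesis .
      qed
    next
      case False
      have "(1 - cos r) * levy_kernel \<alpha> r \<le> 2 * levy_kernel \<alpha> r"
        using cos_ge_minus_one[of r] by (intro mult_right_mono) auto
      also have "\<dots> \<le> g r" using False that by (simp add: g_def levy_kernel_def)
      finally show ?thesis .
    qed
    have "(1 - cos r) * levy_kernel \<alpha> r \<le> g r + g (- r)" for r
      using k[of r] k[of "-r"] g0[of r] g0[of "-r"] by (cases "r \<ge> 0") auto
    then show "AE r in lborel. norm ((1 - cos r) * levy_kernel \<alpha> r) \<le> norm (g r + g (- r))"
      by (intro AE_I2) (auto simp: abs_mult intro: order_trans[OF _ abs_ge_self])
  qed simp
qed

definition levy_const :: "real \<Rightarrow> real" where
  "levy_const \<alpha> = (LINT r|lborel. (1 - cos r) * levy_kernel \<alpha> r)"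

text \<open>Substituting \<open>z * r\<close> reduces to \<open>z = 1\<close>: the kernel is
  homogeneous of degree \<open>- 1 - \<alpha>\<close> and Lebesgue measure of degree 1, which leaves
  \<open>\<bar>z\<bar> powr \<alpha>\<close>.\<close>

lemma has_bochner_integral_one_minus_cos:
  assumes "0 < \<alpha>" "\<alpha> < 2"
  shows "has_bochner_integral lborel (\<lambda>r. (1 - cos (r * z)) * levy_kernel \<alpha> r) (levy_const \<alpha> * \<bar>z\<bar> powr \<alpha>)"
proof (cases "z = 0")
  case False
  have "has_bochner_integral lborel (\<lambda>r. (1 - cos r) * levy_kernel \<alpha> r) (levy_const \<alpha>)"
    using integrable_one_minus_cos_levy_kernel[OF assms] by (simp add: has_bochner_integral_iff levy_const_def)
  from lborel_has_bochner_integral_real_affine_iff[THEN iffD1, OF False this, of 0]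
  have "has_bochner_integral lborel (\<lambda>r. \<bar>z\<bar> powr (1 + \<alpha>) * ((1 - cos (z * r)) * levy_kernel \<alpha> (z * r)))
     (\<bar>z\<bar> powr (1 + \<alpha>) * (levy_const \<alpha> / \<bar>z\<bar>))"
    by (intro has_bochner_integral_mult_right) (auto simp: divide_inverse mult.commute)
  moreover have "\<bar>z\<bar> powr (1 + \<alpha>) * ((1 - cos (z * r)) * levy_kernel \<alpha> (z * r)) = (1 - cos (r * z)) * levy_kernel \<alpha> r" for r
  proof -
    have "\<bar>z\<bar> powr (1 + \<alpha>) * \<bar>z\<bar> powr (- 1 - \<alpha>) = 1"
      using False by (simp add: powr_add[symmetric])
    moreover have "\<bar>z\<bar> powr (1 + \<alpha>) * ((1 - cos (z * r)) * levy_kernel \<alpha> (z * r))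
        = (\<bar>z\<bar> powr (1 + \<alpha>) * \<bar>z\<bar> powr (- 1 - \<alpha>)) * ((1 - cos (r * z)) * levy_kernel \<alpha> r)"
      unfolding levy_kernel_mult by (simp only: mult_ac)
    ultimately show ?thesis by simp
  qed
  moreover have "\<bar>z\<bar> powr (1 + \<alpha>) * (levy_const \<alpha> / \<bar>z\<bar>) = levy_const \<alpha> * \<bar>z\<bar> powr \<alpha>"
    using False by (simp add: powr_add)
  ultimately show ?thesis by simp
qed (simp add: has_bochner_integral_zero)

text \<open>Averaging over \<open>r\<close> and \<open>- r\<close> removes the sine part. The
  identity 2 cos x (1 - cos y) = (1 - cos (x + y)) + (1 - cos (x - y)) - 2 (1 - cos x) reduces the
  rest to the preceding integral.\<close>

lemma integral_cos_one_minus_cos: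
  assumes "0 < \<alpha>" "\<alpha> < 2"
  shows "(LINT r|lborel. cos (c + r * z) * ((1 - cos (r * w)) * levy_kernel \<alpha> r))
     = cos c * (levy_const \<alpha> / 2) * (\<bar>z + w\<bar> powr \<alpha> + \<bar>z - w\<bar> powr \<alpha> - 2 * \<bar>z\<bar> powr \<alpha>)"
proof -
  let ?G = "\<lambda>r. (1 - cos (r * w)) * levy_kernel \<alpha> r"
  note h = has_bochner_integral_one_minus_cos[OF assms]
  have i: "integrable lborel (\<lambda>r. cos (c + r * z) * ?G r)" for c z
    by (rule Bochner_Integration.integrable_bound[of _ ?G])
       (use h[of w] in \<open>auto simp: has_bochner_integral_iff abs_mult intro!: mult_left_le_one_le\<close>)
  have "(LINT r|lborel. cos (c + r * z) * ?G r) = (LINT r|lborel. cos (c - r * z) * ?G r)"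
    using lborel_integral_real_affine[of "-1" "\<lambda>r. cos (c + r * z) * ?G r" 0] by simp
  then have "2 * (LINT r|lborel. cos (c + r * z) * ?G r) = (LINT r|lborel. cos (c + r * z) * ?G r + cos (c - r * z) * ?G r)"
    using i[of c z] i[of c "-z"] by (subst Bochner_Integration.integral_add) auto
  also have "\<dots> = (LINT r|lborel. cos c * ((1 - cos (r * (z + w))) * levy_kernel \<alpha> r + (1 - cos (r * (z - w))) * levy_kernel \<alpha> r
       - 2 * ((1 - cos (r * z)) * levy_kernel \<alpha> r)))"
    by (intro Bochner_Integration.integral_cong refl) (simp add: cos_add cos_diff distrib_left right_diff_distrib, simp add: algebra_simps)
  also have "\<dots> = cos c * (levy_const \<alpha> * \<bar>z + w\<bar> powr \<alpha> + levy_const \<alpha> * \<bar>z - w\<bar> powr \<alpha> - 2 * (levy_const \<alpha> * \<bar>z\<bar> powr \<alpha>))"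
    by (intro has_bochner_integral_integral_eq has_bochner_integral_mult_right has_bochner_integral_diff has_bochner_integral_add h)
  finally show ?thesis by (simp add: algebra_simps)
qed

section \<open>Finite weighted Levy measures and their Fourier transforms\<close>

definition levy_weighted :: "real \<Rightarrow> 'a measure \<Rightarrow> ('a \<Rightarrow> real) \<Rightarrow> (real \<times> 'a) measure" where
  "levy_weighted \<alpha> M w =
     density (lborel \<Otimes>\<^sub>M M) (\<lambda>p. ennreal ((1 - cos (fst p * w (snd p))) * levy_kernel \<alpha> (fst p)))"

lemma sets_levy_weighted [measurable_cong, simp]: "sets (levy_weighted \<alpha> M w) = sets (lborel \<Otimes>\<^sub>M M)"
  by (simp add: levy_weighted_def)

text \<open>Integrating over the radius first leaves
  \<open>levy_const \<alpha> * \<bar>w s\<bar> powr \<alpha>\<close>, which is integrable because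
  \<open>w\<close> is in L^alpha.\<close>

lemma finite_measure_levy_weighted:
  assumes "0 < \<alpha>" "\<alpha> < 2" "sigma_finite_measure M" "in_Lalpha \<alpha> M w"
  shows "finite_measure (levy_weighted \<alpha> M w)"
proof -
  interpret M: sigma_finite_measure M by fact
  interpret L: pair_sigma_finite "lborel :: real measure" M ..
  have [measurable]: "w \<in> borel_measurable M" and i: "integrable M (\<lambda>s. \<bar>w s\<bar> powr \<alpha>)"
    using assms by (auto simp: in_Lalpha_def)
  note h = has_bochner_integral_one_minus_cos[OF assms(1,2)]
  have "emeasure (levy_weighted \<alpha> M w) (space (levy_weighted \<alpha> M w))
    = (\<integral>\<^sup>+p. ennreal ((1 - cos (fst p * w (snd p))) * levy_kernel \<alpha> (fst p)) \<partial>(lborel \<Otimes>\<^sub>M M))"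
    unfolding levy_weighted_def space_density
    by (rule trans[OF emeasure_density nn_integral_cong]) (rule sets.top | simp)+
  also have "\<dots> = (\<integral>\<^sup>+s. (\<integral>\<^sup>+r. ennreal ((1 - cos (r * w s)) * levy_kernel \<alpha> r) \<partial>lborel) \<partial>M)"
    by (subst L.nn_integral_snd[symmetric]) auto
  also have "\<dots> = (\<integral>\<^sup>+s. ennreal (levy_const \<alpha> * \<bar>w s\<bar> powr \<alpha>) \<partial>M)"
    using h by (intro nn_integral_cong) (auto simp: has_bochner_integral_iff nn_integral_eq_integral)
  also have "\<dots> < \<infinity>"
    using integrableD(2)[of M "\<lambda>s. levy_const \<alpha> * \<bar>w s\<bar> powr \<alpha>"] i by (simp add: less_top)
  finally show ?thesis by (intro finite_measureI) auto
qed

text \<open>Fubini, with the radial integral computed first. When \<open>z\<close> and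
  \<open>w\<close> are linear combinations of a representation, so are \<open>z + w\<close> and
  \<open>z - w\<close>, and the right side is determined by scales of the field.\<close>

lemma integral_cos_levy_weighted:
  assumes "0 < \<alpha>" "\<alpha> < 2" "sigma_finite_measure M" "in_Lalpha \<alpha> M w" and [measurable]: "z \<in> borel_measurable M"
  shows "(LINT p|levy_weighted \<alpha> M w. cos (c + fst p * z (snd p)))
    = (LINT s|M. cos c * (levy_const \<alpha> / 2) * (\<bar>z s + w s\<bar> powr \<alpha> + \<bar>z s - w s\<bar> powr \<alpha> - 2 * \<bar>z s\<bar> powr \<alpha>))"
proof -
  interpret M: sigma_finite_measure M by fact
  interpret L: pair_sigma_finite "lborel :: real measure" M ..
  interpret W: finite_measure "levy_weighted \<alpha> M w" by (rule finite_measure_levy_weighted) fact+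
  have [measurable]: "w \<in> borel_measurable M"
    using assms by (auto simp: in_Lalpha_def)
  have "integrable (levy_weighted \<alpha> M w) (\<lambda>p. cos (c + fst p * z (snd p)))"
    by (rule W.integrable_const_bound[of _ 1]) auto
  then have i: "integrable (lborel \<Otimes>\<^sub>M M) (\<lambda>p. ((1 - cos (fst p * w (snd p))) * levy_kernel \<alpha> (fst p)) * cos (c + fst p * z (snd p)))"
    unfolding levy_weighted_def by (subst (asm) integrable_density) auto
  have "(LINT p|levy_weighted \<alpha> M w. cos (c + fst p * z (snd p)))
     = (LINT p|(lborel \<Otimes>\<^sub>M M). ((1 - cos (fst p * w (snd p))) * levy_kernel \<alpha> (fst p)) * cos (c + fst p * z (snd p)))"
    unfolding levy_weighted_def by (subst integral_density) auto
  also have "\<dots> = (LINT s|M. LINT r|lborel. ((1 - cos (r * w s)) * levy_kernel \<alpha> r) * cos (c + r * z s))"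
    using L.integral_snd[of "\<lambda>r s. ((1 - cos (r * w s)) * levy_kernel \<alpha> r) * cos (c + r * z s)"] i
    by (simp add: case_prod_beta')
  also have "\<dots> = (LINT s|M. LINT r|lborel. cos (c + r * z s) * ((1 - cos (r * w s)) * levy_kernel \<alpha> r))"
    by (simp only: mult.commute)
  finally show ?thesis
    by (simp only: integral_cos_one_minus_cos[OF assms(1,2)])
qed

section \<open>Two families whose linear combinations have the same scales\<close>

locale equal_scales =
  fixes \<alpha> :: real and I :: "'i set" and M :: "'a measure" and N :: "'b measure"
    and f :: "'i \<Rightarrow> 'a \<Rightarrow> real" and g :: "'i \<Rightarrow> 'b \<Rightarrow> real"
  assumes alpha: "0 < \<alpha>" "\<alpha> < 2"
    and sigma_finite: "sigma_finite_measure M" "sigma_finite_measure N"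
    and Lalpha: "\<And>t. t \<in> I \<Longrightarrow> in_Lalpha \<alpha> M (f t)" "\<And>t. t \<in> I \<Longrightarrow> in_Lalpha \<alpha> N (g t)"
    and scales: "\<And>F a. finite F \<Longrightarrow> F \<subseteq> I \<Longrightarrow>
      (LINT s|M. \<bar>\<Sum>t\<in>F. a t * f t s\<bar> powr \<alpha>) = (LINT s|N. \<bar>\<Sum>t\<in>F. a t * g t s\<bar> powr \<alpha>)"
begin

lemma measurable_family [measurable]:
  "t \<in> I \<Longrightarrow> f t \<in> borel_measurable M" "t \<in> I \<Longrightarrow> g t \<in> borel_measurable N"
  using Lalpha by (auto simp: in_Lalpha_def)

lemma cos_integrals_eq:
  assumes F: "finite F" "F \<subseteq> I" and u: "u \<in> I"
  shows "(LINT p|levy_weighted \<alpha> M (f u). cos (c + (\<Sum>t\<in>F. a t * (fst p * f t (snd p)))))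
    = (LINT p|levy_weighted \<alpha> N (g u). cos (c + (\<Sum>t\<in>F. a t * (fst p * g t (snd p)))))"
proof -
  define F' where "F' = insert u F"
  have F': "finite F'" "F' \<subseteq> I" using F u by (auto simp: F'_def)
  \<comment> \<open>Coefficients of the given combination plus \<open>e\<close> times member
    \<open>u\<close>, used for \<open>e\<close> equal to 0, 1 and -1. The index \<open>u\<close> may
    already belong to \<open>F\<close>.\<close>
  define b where "b e t = (if t \<in> F then a t else 0) + (if t = u then e else 0)" for e :: real and t
  have b: "(\<Sum>t\<in>F'. b e t * h t) = (\<Sum>t\<in>F. a t * h t) + e * h u" for e and h :: "'i \<Rightarrow> real"
  proof -
    have "(\<Sum>t\<in>F'. b e t * h t) = (\<Sum>t\<in>F'. if t \<in> F then a t * h t else 0) + (\<Sum>t\<in>F'. if t = u then e * h t else 0)"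
      unfolding sum.distrib[symmetric] b_def by (intro sum.cong) (auto simp: distrib_right)
    also have "(\<Sum>t\<in>F'. if t \<in> F then a t * h t else 0) = (\<Sum>t\<in>F. a t * h t)"
      using F by (intro sum.mono_neutral_cong_right) (auto simp: F'_def)
    also have "(\<Sum>t\<in>F'. if t = u then e * h t else 0) = e * h u"
      using F' by (simp add: F'_def)
    finally show ?thesis .
  qed
  let ?f = "\<lambda>e s. \<Sum>t\<in>F'. b e t * f t s" and ?g = "\<lambda>e s. \<Sum>t\<in>F'. b e t * g t s"
  have L: "in_Lalpha \<alpha> M (?f e)" "in_Lalpha \<alpha> N (?g e)" for e
    using F' alpha by (auto intro!: in_Lalpha_sum Lalpha)
  have i: "integrable M (\<lambda>s. \<bar>?f e s\<bar> powr \<alpha>)" "integrable N (\<lambda>s. \<bar>?g e s\<bar> powr \<alpha>)" for e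
    using L by (auto simp: in_Lalpha_def)
  have [measurable]: "?f e \<in> borel_measurable M" "?g e \<in> borel_measurable N" for e
    using L by (auto simp: in_Lalpha_def)
  have "(LINT p|levy_weighted \<alpha> M (f u). cos (c + (\<Sum>t\<in>F. a t * (fst p * f t (snd p)))))
     = (LINT p|levy_weighted \<alpha> M (f u). cos (c + fst p * ?f 0 (snd p)))"
    unfolding b by (simp add: sum_distrib_left mult_ac)
  also have "\<dots> = (LINT s|M. cos c * (levy_const \<alpha> / 2) * (\<bar>?f 1 s\<bar> powr \<alpha> + \<bar>?f (- 1) s\<bar> powr \<alpha> - 2 * \<bar>?f 0 s\<bar> powr \<alpha>))"
    by (subst integral_cos_levy_weighted[OF alpha sigma_finite(1) Lalpha(1)[OF u]]) (measurable, simp add: b)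
  also have "\<dots> = (LINT s|N. cos c * (levy_const \<alpha> / 2) * (\<bar>?g 1 s\<bar> powr \<alpha> + \<bar>?g (- 1) s\<bar> powr \<alpha> - 2 * \<bar>?g 0 s\<bar> powr \<alpha>))"
    using i by (simp add: scales[OF F'])
  also have "\<dots> = (LINT p|levy_weighted \<alpha> N (g u). cos (c + fst p * ?g 0 (snd p)))"
    by (subst integral_cos_levy_weighted[OF alpha sigma_finite(2) Lalpha(2)[OF u]]) (measurable, simp add: b)
  also have "\<dots> = (LINT p|levy_weighted \<alpha> N (g u). cos (c + (\<Sum>t\<in>F. a t * (fst p * g t (snd p)))))"
    unfolding b by (simp add: sum_distrib_left mult_ac)
  finally show ?thesis .
qed

text \<open>The weight makes the image measures finite, so agreement on cylinders over finite index
  sets suffices; there \<open>cos_integrals_eq\<close> determines the joint law.\<close>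

lemma distr_levy_weighted_eq:
  assumes u: "u \<in> I"
  shows "distr (levy_weighted \<alpha> M (f u)) (Pi\<^sub>M I (\<lambda>_. borel)) (\<lambda>p. \<lambda>t\<in>I. fst p * f t (snd p))
    = distr (levy_weighted \<alpha> N (g u)) (Pi\<^sub>M I (\<lambda>_. borel)) (\<lambda>p. \<lambda>t\<in>I. fst p * g t (snd p))" (is "?L = ?R")
proof (rule measure_eqI_PiM_infinite)
  interpret M: finite_measure "levy_weighted \<alpha> M (f u)"
    by (intro finite_measure_levy_weighted alpha sigma_finite Lalpha u)
  interpret N: finite_measure "levy_weighted \<alpha> N (g u)"
    by (intro finite_measure_levy_weighted alpha sigma_finite Lalpha u)
  show "finite_measure ?L" by (rule M.finite_measure_distr) measurable
  fix A and J :: "'i set" assume J: "finite J" "J \<subseteq> I" and A: "\<And>i. i \<in> J \<Longrightarrow> A i \<in> sets (borel :: real measure)"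
  have [measurable]: "prod_emb I (\<lambda>_. borel) J (Pi\<^sub>E J A) \<in> sets (Pi\<^sub>M I (\<lambda>_. borel :: real measure))"
    using J A by (intro sets_PiM_I) auto
  have mm: "t \<in> J \<Longrightarrow> (\<lambda>p. fst p * f t (snd p)) \<in> borel_measurable (levy_weighted \<alpha> M (f u))"
    "t \<in> J \<Longrightarrow> (\<lambda>p. fst p * g t (snd p)) \<in> borel_measurable (levy_weighted \<alpha> N (g u))" for t
    using J by (auto intro!: measurable_family)
  have vimage: "(\<lambda>p. \<lambda>t\<in>I. fst p * h t (snd p)) -` prod_emb I (\<lambda>_. borel) J (Pi\<^sub>E J A) \<inter> S
    = {p \<in> S. \<forall>t\<in>J. fst p * h t (snd p) \<in> A t}" for h :: "'i \<Rightarrow> 'c \<Rightarrow> real" and S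
    using J by (auto simp: prod_emb_def PiE_iff extensional_def restrict_def subset_eq split: if_splits)
  have "emeasure (levy_weighted \<alpha> M (f u)) {p \<in> space (levy_weighted \<alpha> M (f u)). \<forall>t\<in>J. fst p * f t (snd p) \<in> A t}
     = emeasure (levy_weighted \<alpha> N (g u)) {p \<in> space (levy_weighted \<alpha> N (g u)). \<forall>t\<in>J. fst p * g t (snd p) \<in> A t}"
    using cos_integrals_determine_joint_law[OF J(1) M.finite_measure_axioms N.finite_measure_axioms mm cos_integrals_eq[OF J u] A]
    by (simp add: M.emeasure_eq_measure N.emeasure_eq_measure)
  then show "emeasure ?L (prod_emb I (\<lambda>_. borel) J (Pi\<^sub>E J A)) = emeasure ?R (prod_emb I (\<lambda>_. borel) J (Pi\<^sub>E J A))"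
    by (simp add: emeasure_distr vimage)
qed simp_all

end

section \<open>Directions and the spectral measure\<close>

text \<open>If all coordinates vanish, \<open>LEAST\<close> yields an unspecified index. For
  nonempty \<open>I\<close>, \<open>lead\<close> is then still 0, and division by zero makes
  \<open>direction\<close> zero on \<open>I\<close>.\<close>

definition lead_index :: "'i set \<Rightarrow> ('i \<Rightarrow> real) \<Rightarrow> nat" where
  "lead_index I x = (LEAST n. x (from_nat_into I n) \<noteq> 0)"

definition lead :: "'i set \<Rightarrow> ('i \<Rightarrow> real) \<Rightarrow> real" where
  "lead I x = x (from_nat_into I (lead_index I x))"

text \<open>A normal form of the line through \<open>x\<close>: nonzero multiples of either sign
  share it.\<close>

definition direction :: "'i set \<Rightarrow> ('i \<Rightarrow> real) \<Rightarrow> 'i \<Rightarrow> real" where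
  "direction I x = (\<lambda>t\<in>I. x t / lead I x)"

lemma lead_index_cong: "(\<And>t. t \<in> I \<Longrightarrow> x t = 0 \<longleftrightarrow> y t = 0) \<Longrightarrow> I \<noteq> {} \<Longrightarrow> lead_index I x = lead_index I y"
  unfolding lead_index_def by (simp add: from_nat_into)

lemma lead_scale:
  assumes "\<And>t. t \<in> I \<Longrightarrow> x t = c * y t" "c \<noteq> 0" "I \<noteq> {}"
  shows "lead I x = c * lead I y"
  using assms lead_index_cong[of I x y] by (simp add: lead_def from_nat_into)

lemma direction_scale:
  assumes "\<And>t. t \<in> I \<Longrightarrow> x t = c * y t" "c \<noteq> 0" "I \<noteq> {}"
  shows "direction I x = direction I y"
  using assms lead_scale[of I x c y] by (auto simp: direction_def)

lemma lead_eq_0_iff: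
  assumes "countable I" "I \<noteq> {}"
  shows "lead I x = 0 \<longleftrightarrow> (\<forall>t\<in>I. x t = 0)"
proof
  assume 0: "lead I x = 0"
  show "\<forall>t\<in>I. x t = 0"
  proof (rule ccontr)
    assume "\<not> (\<forall>t\<in>I. x t = 0)"
    then obtain n where "x (from_nat_into I n) \<noteq> 0"
      using from_nat_into_surj[OF assms(1)] by metis
    then have "x (from_nat_into I (LEAST n. x (from_nat_into I n) \<noteq> 0)) \<noteq> 0"
      by (rule LeastI)
    with 0 show False by (simp add: lead_def lead_index_def)
  qed
qed (simp add: lead_def from_nat_into assms)

lemma lead_times_direction:
  assumes "countable I" "t \<in> I"
  shows "lead I x * direction I x t = x t"
  using assms lead_eq_0_iff[of I x] by (cases "lead I x = 0") (auto simp: direction_def)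

lemma lead_index_measurable:
  assumes "I \<noteq> {}" and f: "\<And>t. t \<in> I \<Longrightarrow> f t \<in> borel_measurable M"
  shows "(\<lambda>s. lead_index I (\<lambda>t. f t s)) \<in> M \<rightarrow>\<^sub>M count_space UNIV"
proof -
  have [measurable]: "f (from_nat_into I n) \<in> borel_measurable M" for n
    by (intro f from_nat_into assms)
  show ?thesis unfolding lead_index_def by measurable
qed

lemma lead_measurable:
  assumes "I \<noteq> {}" and f: "\<And>t. t \<in> I \<Longrightarrow> f t \<in> borel_measurable M"
  shows "(\<lambda>s. lead I (\<lambda>t. f t s)) \<in> borel_measurable M"
  unfolding lead_def
  by (rule measurable_compose_countable[OF _ lead_index_measurable]) (auto intro!: assms from_nat_into)

lemma direction_measurable:
  assumes "I \<noteq> {}" and f: "\<And>t. t \<in> I \<Longrightarrow> f t \<in> borel_measurable M"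
  shows "(\<lambda>s. direction I (\<lambda>t. f t s)) \<in> M \<rightarrow>\<^sub>M Pi\<^sub>M I (\<lambda>_. borel)"
  unfolding direction_def
  by (intro measurable_restrict borel_measurable_divide lead_measurable assms)

lemma PiM_lead_measurable:
  assumes "I \<noteq> {}"
  shows "lead_index I \<in> Pi\<^sub>M I (\<lambda>_. borel) \<rightarrow>\<^sub>M count_space UNIV"
    and "lead I \<in> borel_measurable (Pi\<^sub>M I (\<lambda>_. borel))"
    and "direction I \<in> Pi\<^sub>M I (\<lambda>_. borel) \<rightarrow>\<^sub>M Pi\<^sub>M I (\<lambda>_. borel)"
  using lead_index_measurable[OF assms, of "\<lambda>t x. x t"] lead_measurable[OF assms, of "\<lambda>t x. x t"]
    direction_measurable[OF assms, of "\<lambda>t x. x t"]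
  by (auto simp: measurable_component_singleton)

section \<open>Removing the radial variable by means of a band\<close>

definition band_mass :: "real \<Rightarrow> ennreal" where
  "band_mass \<alpha> = (\<integral>\<^sup>+r. indicator {r. 1 < \<bar>r\<bar> \<and> \<bar>r\<bar> < 2} r * ennreal (levy_kernel \<alpha> r) \<partial>lborel)"

text \<open>Substituting \<open>c * r\<close> produces \<open>\<bar>c\<bar>\<close> from Lebesgue
  measure and \<open>\<bar>c\<bar> powr (- 1 - \<alpha>)\<close> from the kernel, together the
  inverse of \<open>\<bar>c\<bar> powr \<alpha>\<close>. For \<open>c = 0\<close> both sides
  vanish.\<close>

lemma band_mass_scale:
  "(\<integral>\<^sup>+r. indicator {r. 1 < \<bar>r * c\<bar> \<and> \<bar>r * c\<bar> < 2} r * ennreal (levy_kernel \<alpha> r) \<partial>lborel) = ennreal (\<bar>c\<bar> powr \<alpha>) * band_mass \<alpha>"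
proof (cases "c = 0")
  case False
  let ?J = "\<integral>\<^sup>+r. indicator {r. 1 < \<bar>r * c\<bar> \<and> \<bar>r * c\<bar> < 2} r * ennreal (levy_kernel \<alpha> r) \<partial>lborel"
  have "band_mass \<alpha> = \<bar>c\<bar> * (\<integral>\<^sup>+r. indicator {r. 1 < \<bar>r\<bar> \<and> \<bar>r\<bar> < 2} (0 + c * r) * ennreal (levy_kernel \<alpha> (0 + c * r)) \<partial>lborel)"
    unfolding band_mass_def by (rule nn_integral_real_affine[OF _ False]) measurable
  also have "\<dots> = \<bar>c\<bar> * (\<integral>\<^sup>+r. ennreal (\<bar>c\<bar> powr (- 1 - \<alpha>)) * (indicator {r. 1 < \<bar>r * c\<bar> \<and> \<bar>r * c\<bar> < 2} r * ennreal (levy_kernel \<alpha> r)) \<partial>lborel)"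
    unfolding add_0 levy_kernel_mult
    by (rule arg_cong2[where f="(*)", OF refl nn_integral_cong])
       (auto simp: ennreal_mult mult.commute[of c] split: split_indicator)
  also have "\<dots> = \<bar>c\<bar> * (ennreal (\<bar>c\<bar> powr (- 1 - \<alpha>)) * ?J)"
    by (subst nn_integral_cmult) auto
  finally have "ennreal (\<bar>c\<bar> powr \<alpha>) * band_mass \<alpha> = (ennreal (\<bar>c\<bar> powr \<alpha>) * ennreal \<bar>c\<bar> * ennreal (\<bar>c\<bar> powr (- 1 - \<alpha>))) * ?J"
    by (simp add: mult.assoc)
  also have "ennreal (\<bar>c\<bar> powr \<alpha>) * ennreal \<bar>c\<bar> * ennreal (\<bar>c\<bar> powr (- 1 - \<alpha>)) = 1"
  proof -
    have "\<bar>c\<bar> powr \<alpha> * \<bar>c\<bar> powr 1 * \<bar>c\<bar> powr (- 1 - \<alpha>) = 1"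
      using False unfolding powr_add[symmetric] by simp
    then show ?thesis using False by (simp add: ennreal_mult[symmetric])
  qed
  finally show ?thesis by simp
qed simp

text \<open>On the band the kernel lies between \<open>2 powr (- 1 - \<alpha>)\<close> and 1. Being
  positive and finite, this constant can be cancelled in \<open>spectral_measure_eq\<close>.\<close>

lemma band_mass_finite_pos:
  assumes "0 < \<alpha>"
  shows "band_mass \<alpha> \<noteq> 0" "band_mass \<alpha> \<noteq> \<infinity>"
proof -
  have "(\<integral>\<^sup>+r. indicator {1<..<2::real} r * ennreal (2 powr (- 1 - \<alpha>)) \<partial>lborel) \<le> band_mass \<alpha>"
    unfolding band_mass_def using assms
    by (intro nn_integral_mono) (auto split: split_indicator simp: levy_kernel_def intro!: ennreal_leI powr_mono2')
  moreover have "(\<integral>\<^sup>+r. indicator {1<..<2::real} r * ennreal (2 powr (- 1 - \<alpha>)) \<partial>lborel) = ennreal (2 powr (- 1 - \<alpha>))"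
    by (subst nn_integral_multc) auto
  ultimately show "band_mass \<alpha> \<noteq> 0" by auto
  have "band_mass \<alpha> \<le> (\<integral>\<^sup>+r. indicator {-2..2::real} r \<partial>lborel)"
    unfolding band_mass_def using assms powr_mono2'[of "- 1 - \<alpha>" 1]
    by (intro nn_integral_mono) (auto split: split_indicator simp: levy_kernel_def)
  also have "\<dots> = 4" by simp
  finally show "band_mass \<alpha> \<noteq> \<infinity>" by (auto simp: top_unique)
qed

text \<open>On the cone where coordinate number \<open>n\<close> is the leading one, the weight
  \<open>1 - cos\<close> is bounded away from zero on the band \<open>1 < \<bar>lead\<bar> < 2\<close>, so that it can be divided
  out; the radial integral then leaves \<open>\<bar>lead\<bar>\<^sup>\<alpha>\<close> by scaling.\<close>

lemma band_integral:
  fixes f :: "'i \<Rightarrow> 'a \<Rightarrow> real" and M :: "'a measure" and n :: nat and I :: "'i set"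
  defines "Y \<equiv> Pi\<^sub>M I (\<lambda>_. borel :: real measure)"
    and "u \<equiv> from_nat_into I n"
  assumes M: "sigma_finite_measure M" and I: "countable I" "I \<noteq> {}"
    and f: "\<And>t. t \<in> I \<Longrightarrow> f t \<in> borel_measurable M" and D: "D \<in> sets Y"
  shows "(\<integral>\<^sup>+y. indicator {y\<in>space Y. lead_index I y = n \<and> 1 < \<bar>lead I y\<bar> \<and> \<bar>lead I y\<bar> < 2 \<and> direction I y \<in> D} y
        * ennreal (1 / (1 - cos (y u)))
      \<partial>distr (levy_weighted \<alpha> M (f u)) Y (\<lambda>p. \<lambda>t\<in>I. fst p * f t (snd p)))
   = band_mass \<alpha> * emeasure (density M (\<lambda>s. ennreal (\<bar>lead I (\<lambda>t. f t s)\<bar> powr \<alpha>)))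
        {s\<in>space M. lead_index I (\<lambda>t. f t s) = n \<and> direction I (\<lambda>t. f t s) \<in> D}"
proof -
  interpret M: sigma_finite_measure M by fact
  interpret L: pair_sigma_finite "lborel :: real measure" M ..
  have u: "u \<in> I" unfolding u_def using I by (simp add: from_nat_into)
  note [measurable] = f D f[OF u] PiM_lead_measurable[OF I(2), folded Y_def]
    lead_index_measurable[OF I(2) f, simplified] lead_measurable[OF I(2) f, simplified] direction_measurable[OF I(2) f, folded Y_def, simplified]
  have [measurable]: "(\<lambda>y. y u) \<in> borel_measurable Y"
    unfolding Y_def using u by (rule measurable_component_singleton)
  have [measurable]: "(\<lambda>p. \<lambda>t\<in>I. fst p * f t (snd p)) \<in> levy_weighted \<alpha> M (f u) \<rightarrow>\<^sub>M Y"
    unfolding Y_def by measurable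
  have [measurable]: "(\<lambda>p. \<lambda>t\<in>I. fst p * f t (snd p)) \<in> (lborel :: real measure) \<Otimes>\<^sub>M M \<rightarrow>\<^sub>M Y"
    unfolding Y_def by measurable
  define B where "B = {y\<in>space Y. lead_index I y = n \<and> 1 < \<bar>lead I y\<bar> \<and> \<bar>lead I y\<bar> < 2 \<and> direction I y \<in> D}"
  have [measurable]: "B \<in> sets Y" unfolding B_def by measurable
  define S where "S = {s\<in>space M. lead_index I (\<lambda>t. f t s) = n \<and> direction I (\<lambda>t. f t s) \<in> D}"
  have [measurable]: "S \<in> sets M" unfolding S_def by measurable
  let ?v = "\<lambda>p. \<lambda>t\<in>I. fst p * f t (snd p)"
  have "(\<integral>\<^sup>+y. indicator B y * ennreal (1 / (1 - cos (y u))) \<partial>distr (levy_weighted \<alpha> M (f u)) Y ?v)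
    = (\<integral>\<^sup>+p. indicator B (?v p) * ennreal (1 / (1 - cos (?v p u))) \<partial>levy_weighted \<alpha> M (f u))"
    by (rule nn_integral_distr) measurable
  also have "\<dots> = (\<integral>\<^sup>+p. ennreal ((1 - cos (fst p * f u (snd p))) * levy_kernel \<alpha> (fst p)) * (indicator B (?v p) * ennreal (1 / (1 - cos (?v p u)))) \<partial>(lborel \<Otimes>\<^sub>M M))"
    unfolding levy_weighted_def
    by (rule nn_integral_density) measurable
  also have "\<dots> = (\<integral>\<^sup>+p. indicator S (snd p) * (indicator {r. 1 < \<bar>r * lead I (\<lambda>t. f t (snd p))\<bar> \<and> \<bar>r * lead I (\<lambda>t. f t (snd p))\<bar> < 2} (fst p) * ennreal (levy_kernel \<alpha> (fst p))) \<partial>(lborel \<Otimes>\<^sub>M M))"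
  proof (rule nn_integral_cong)
    fix p :: "real \<times> 'a" assume p: "p \<in> space (lborel \<Otimes>\<^sub>M M)"
    obtain r s where [simp]: "p = (r, s)" by force
    have s: "s \<in> space M" using p by (simp add: space_pair_measure)
    show "ennreal ((1 - cos (fst p * f u (snd p))) * levy_kernel \<alpha> (fst p)) * (indicator B (?v p) * ennreal (1 / (1 - cos (?v p u))))
      = indicator S (snd p) * (indicator {r. 1 < \<bar>r * lead I (\<lambda>t. f t (snd p))\<bar> \<and> \<bar>r * lead I (\<lambda>t. f t (snd p))\<bar> < 2} (fst p) * ennreal (levy_kernel \<alpha> (fst p)))"
    \<comment> \<open>Scaling by 0 would destroy the direction, but there the kernel is 0, as
      \<open>0 powr x = 0\<close>.\<close>
    proof (cases "r = 0")
      case True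
      then show ?thesis by (simp add: levy_kernel_def)
    next
      case False
      have l: "lead_index I (?v p) = lead_index I (\<lambda>t. f t s)" "lead I (?v p) = r * lead I (\<lambda>t. f t s)"
         "direction I (?v p) = direction I (\<lambda>t. f t s)"
        using False I by (auto intro!: lead_index_cong lead_scale direction_scale)
      have B: "?v p \<in> B \<longleftrightarrow> s \<in> S \<and> 1 < \<bar>r * lead I (\<lambda>t. f t s)\<bar> \<and> \<bar>r * lead I (\<lambda>t. f t s)\<bar> < 2"
        unfolding B_def S_def using s by (auto simp only: l mem_Collect_eq) (auto simp: Y_def space_PiM)
      show ?thesis
      proof (cases "?v p \<in> B")
        case True
        with B have "s \<in> S" and b: "1 < \<bar>r * lead I (\<lambda>t. f t s)\<bar>" "\<bar>r * lead I (\<lambda>t. f t s)\<bar> < 2" by auto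
        then have "lead I (\<lambda>t. f t s) = f u s" by (simp add: S_def lead_def u_def)
        with b have b': "1 < \<bar>r * f u s\<bar>" "\<bar>r * f u s\<bar> < 2" by auto
        \<comment> \<open>The argument lies strictly between 0 and pi, so the weight is positive and
          its reciprocal cancels it.\<close>
        have "cos \<bar>r * f u s\<bar> < cos 0"
          using b' pi_gt3 by (intro cos_monotone_0_pi) auto
        then have "cos (r * f u s) < 1" by simp
        then show ?thesis
          using True B u by (simp add: ennreal_mult''[symmetric])
      next
        case False
        then show ?thesis using B by (auto split: split_indicator)
      qed
    qed
  qed
  also have "\<dots> = (\<integral>\<^sup>+s. (\<integral>\<^sup>+r. indicator S s * (indicator {r. 1 < \<bar>r * lead I (\<lambda>t. f t s)\<bar> \<and> \<bar>r * lead I (\<lambda>t. f t s)\<bar> < 2} r * ennreal (levy_kernel \<alpha> r)) \<partial>lborel) \<partial>M)"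
    using L.nn_integral_snd[of "\<lambda>p. indicator S (snd p) * (indicator {r. 1 < \<bar>r * lead I (\<lambda>t. f t (snd p))\<bar> \<and> \<bar>r * lead I (\<lambda>t. f t (snd p))\<bar> < 2} (fst p) * ennreal (levy_kernel \<alpha> (fst p)))", symmetric]
    by simp
  also have "\<dots> = (\<integral>\<^sup>+s. indicator S s * (ennreal (\<bar>lead I (\<lambda>t. f t s)\<bar> powr \<alpha>) * band_mass \<alpha>) \<partial>M)"
    by (intro nn_integral_cong) (simp add: nn_integral_cmult band_mass_scale)
  also have "\<dots> = (\<integral>\<^sup>+s. band_mass \<alpha> * (ennreal (\<bar>lead I (\<lambda>t. f t s)\<bar> powr \<alpha>) * indicator S s) \<partial>M)"
    by (simp add: mult_ac)
  also have "\<dots> = band_mass \<alpha> * (\<integral>\<^sup>+s. (ennreal (\<bar>lead I (\<lambda>t. f t s)\<bar> powr \<alpha>) * indicator S s) \<partial>M)"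
    by (rule nn_integral_cmult) measurable
  also have "\<dots> = band_mass \<alpha> * emeasure (density M (\<lambda>s. ennreal (\<bar>lead I (\<lambda>t. f t s)\<bar> powr \<alpha>))) S"
    by (subst emeasure_density) auto
  finally show ?thesis unfolding B_def S_def .
qed

text \<open>Analogue of the spectral measure on the unit sphere: the leading coordinate replaces the
  norm, and opposite directions are identified.\<close>

definition spectral_measure :: "real \<Rightarrow> 'i set \<Rightarrow> 'a measure \<Rightarrow> ('i \<Rightarrow> 'a \<Rightarrow> real) \<Rightarrow> ('i \<Rightarrow> real) measure" where
  "spectral_measure \<alpha> I M f =
     distr (density M (\<lambda>s. ennreal (\<bar>lead I (\<lambda>t. f t s)\<bar> powr \<alpha>))) (Pi\<^sub>M I (\<lambda>_. borel)) (\<lambda>s. direction I (\<lambda>t. f t s))"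

text \<open>Countable additivity over the leading index, because \<open>band_integral\<close> treats
  one cone at a time with a weight adapted to it.\<close>

lemma emeasure_spectral_measure:
  assumes I: "countable I" "I \<noteq> {}" and f: "\<And>t. t \<in> I \<Longrightarrow> f t \<in> borel_measurable M" and D: "D \<in> sets (Pi\<^sub>M I (\<lambda>_. borel))"
  shows "emeasure (spectral_measure \<alpha> I M f) D
    = (\<Sum>n. emeasure (density M (\<lambda>s. ennreal (\<bar>lead I (\<lambda>t. f t s)\<bar> powr \<alpha>)))
        {s\<in>space M. lead_index I (\<lambda>t. f t s) = n \<and> direction I (\<lambda>t. f t s) \<in> D})"
proof -
  note [measurable] = D lead_index_measurable[OF I(2) f, simplified] direction_measurable[OF I(2) f, simplified]
  show ?thesis unfolding spectral_measure_def
    by (subst emeasure_distr, simp, simp, subst suminf_emeasure)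
       (auto simp: disjoint_family_on_def intro!: arg_cong2[where f=emeasure])
qed

text \<open>On the cone with leading index \<open>n\<close>, \<open>band_integral\<close> expresses
  \<open>band_mass\<close> times the mass as an integral against the image measure weighted by
  coordinate number \<open>n\<close>. That measure is common to both families, so the factor is
  cancelled and the cones are summed.\<close>

lemma (in equal_scales) spectral_measure_eq:
  assumes I: "countable I" "I \<noteq> {}"
  shows "spectral_measure \<alpha> I M f = spectral_measure \<alpha> I N g"
proof (rule measure_eqI)
  fix D assume "D \<in> sets (spectral_measure \<alpha> I M f)"
  then have D: "D \<in> sets (Pi\<^sub>M I (\<lambda>_. borel))" by (simp add: spectral_measure_def)
  have "emeasure (density M (\<lambda>s. ennreal (\<bar>lead I (\<lambda>t. f t s)\<bar> powr \<alpha>)))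
        {s\<in>space M. lead_index I (\<lambda>t. f t s) = n \<and> direction I (\<lambda>t. f t s) \<in> D}
     = emeasure (density N (\<lambda>s. ennreal (\<bar>lead I (\<lambda>t. g t s)\<bar> powr \<alpha>)))
        {s\<in>space N. lead_index I (\<lambda>t. g t s) = n \<and> direction I (\<lambda>t. g t s) \<in> D}" for n
  proof -
    have u: "from_nat_into I n \<in> I" using I by (simp add: from_nat_into)
    have "band_mass \<alpha> * emeasure (density M (\<lambda>s. ennreal (\<bar>lead I (\<lambda>t. f t s)\<bar> powr \<alpha>)))
        {s\<in>space M. lead_index I (\<lambda>t. f t s) = n \<and> direction I (\<lambda>t. f t s) \<in> D}
      = band_mass \<alpha> * emeasure (density N (\<lambda>s. ennreal (\<bar>lead I (\<lambda>t. g t s)\<bar> powr \<alpha>)))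
        {s\<in>space N. lead_index I (\<lambda>t. g t s) = n \<and> direction I (\<lambda>t. g t s) \<in> D}"
      using band_integral[where f=f and \<alpha>=\<alpha> and n=n, OF sigma_finite(1) I measurable_family(1) D]
        band_integral[where f=g and \<alpha>=\<alpha> and n=n, OF sigma_finite(2) I measurable_family(2) D]
      unfolding distr_levy_weighted_eq[OF u] by simp
    then show ?thesis
      using band_mass_finite_pos[OF alpha(1)] by (simp add: ennreal_mult_cancel_left)
  qed
  then show "emeasure (spectral_measure \<alpha> I M f) D = emeasure (spectral_measure \<alpha> I N g) D"
    by (simp add: emeasure_spectral_measure[OF I _ D] measurable_family)
qed (simp add: spectral_measure_def)

section \<open>Recovering a point of a standard space\<close>

lemma standard_measure_space_dense_metric:
  assumes "standard_measure_space M" "space M \<noteq> {}"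
  obtains d x where "Metric_space (space M) d" "Metric_space.mcomplete (space M) d"
    "sets M = sigma_sets (space M) {W. openin (Metric_space.mtopology (space M) d) W}"
    "range x \<subseteq> space M" "\<And>s e. s \<in> space M \<Longrightarrow> e > 0 \<Longrightarrow> \<exists>j::nat. d (x j) s < e"
proof -
  obtain T where T: "completely_metrizable_space T" "second_countable T" "topspace T = space M"
     "sets M = sigma_sets (space M) {W. openin T W}"
    using assms by (auto simp: standard_measure_space_def)
  obtain S d where S: "Metric_space S d" "Metric_space.mcomplete S d" "T = Metric_space.mtopology S d"
    using T(1) by (auto simp: completely_metrizable_space_def)
  have "S = space M" using T(3) S(3) Metric_space.topspace_mtopology[OF S(1)] by simp
  note S = S[unfolded this]
  interpret Metric_space "space M" d by (rule S)
  have "separable_space T" using T(2) by (rule second_countable_imp_separable_space)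
  then obtain C where C: "countable C" "C \<subseteq> space M" "T closure_of C = space M"
    using T(3) by (auto simp: separable_space_def)
  have "C \<noteq> {}" using C(3) assms(2) by auto
  have "\<exists>j. d (from_nat_into C j) s < e" if s: "s \<in> space M" and e: "e > 0" for s e
  proof -
    have "s \<in> T closure_of C" using C s by simp
    then obtain y where "y \<in> C" "y \<in> mball s e"
      unfolding S(3) metric_closure_of using e by auto
    then have "d y s < e" by (simp add: in_mball commute)
    with from_nat_into_surj[OF C(1) \<open>y \<in> C\<close>] show ?thesis by metis
  qed
  moreover have "range (from_nat_into C) \<subseteq> space M"
    using C \<open>C \<noteq> {}\<close> from_nat_into by blast
  ultimately show thesis using that S T by auto
qed

text \<open>A point of a Polish space is the limit of members of a dense sequence. The index of the
  approximating member is, up to null sets, a function of \<open>U\<close>, and completeness makes the limit a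
  measurable function of \<open>U\<close>.\<close>

lemma measurable_left_inverse_mod_null:
  fixes M :: "'a measure" and U :: "'a \<Rightarrow> 'y"
  assumes M: "standard_measure_space M" "space M \<noteq> {}" and [measurable]: "U \<in> M \<rightarrow>\<^sub>M Y"
    and gen: "\<And>B. B \<in> sets M \<Longrightarrow> \<exists>D\<in>sets Y. AE s in M. s \<in> B \<longleftrightarrow> U s \<in> D"
  shows "\<exists>g. g \<in> Y \<rightarrow>\<^sub>M M \<and> (AE s in M. g (U s) = s)"
proof -
  obtain d x where md: "Metric_space (space M) d" and mc: "Metric_space.mcomplete (space M) d"
    and setsM: "sets M = sigma_sets (space M) {W. openin (Metric_space.mtopology (space M) d) W}"
    and x: "range x \<subseteq> space M" and dense: "\<And>s e. s \<in> space M \<Longrightarrow> e > 0 \<Longrightarrow> \<exists>j::nat. d (x j) s < e"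
    using standard_measure_space_dense_metric[OF M] by metis
  interpret Metric_space "space M" d by fact
  have xM[simp]: "x j \<in> space M" for j using x by auto
  define r where "r n = inverse (real (Suc n))" for n
  have r: "r n > 0" for n by (simp add: r_def)
  have ball: "mball (x j) (r n) \<in> sets M" for j n
    unfolding setsM by (auto intro!: sigma_sets.Basic)
  have "\<forall>n j. \<exists>D. D \<in> sets Y \<and> (AE s in M. s \<in> mball (x j) (r n) \<longleftrightarrow> U s \<in> D)"
    using gen[OF ball] by blast
  then obtain D where D[measurable]: "\<And>n j. D n j \<in> sets Y"
    and AED: "\<And>n j. AE s in M. s \<in> mball (x j) (r n) \<longleftrightarrow> U s \<in> D n j"
    by metis
  \<comment> \<open>Arbitrary if \<open>y\<close> lies in no \<open>D n j\<close>; for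
    \<open>y = U s\<close> this happens only for \<open>s\<close> in a null set.\<close>
  define i where "i n y = (LEAST j. y \<in> D n j)" for n y
  have im[measurable]: "i n \<in> Y \<rightarrow>\<^sub>M count_space UNIV" for n
    unfolding i_def by measurable
  define a where "a n y = x (i n y)" for n y
  \<comment> \<open>The Cauchy condition, with quantifiers over naturals only, so that the set is
    measurable. Outside it \<open>g\<close> takes the default value \<open>x 0\<close>.\<close>
  define Conv where "Conv = {y \<in> space Y. \<forall>k. \<exists>N. \<forall>m\<ge>N. \<forall>n\<ge>N. d (a m y) (a n y) < r k}"
  have [measurable]: "Conv \<in> sets Y"
  proof -
    have [measurable]: "Measurable.pred Y (\<lambda>y. d (a m y) (a n y) < r k)" for m n k
      unfolding a_def by measurable
    show ?thesis unfolding Conv_def by measurable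
  qed
  have ex_r: "\<exists>k. r k < e" if "e > 0" for e using reals_Archimedean[OF that] by (simp add: r_def)
  have Conv: "\<exists>l. limitin mtopology (\<lambda>n. a n y) l sequentially" if y: "y \<in> Conv" for y
  proof -
    have "MCauchy (\<lambda>n. a n y)"
      unfolding MCauchy_def
    proof (intro conjI allI impI)
      fix e :: real assume "e > 0"
      then obtain k where k: "r k < e" using ex_r by blast
      obtain N where "\<forall>m\<ge>N. \<forall>n\<ge>N. d (a m y) (a n y) < r k" using y unfolding Conv_def by blast
      with k show "\<exists>N. \<forall>n n'. N \<le> n \<longrightarrow> N \<le> n' \<longrightarrow> d (a n y) (a n' y) < e" by (meson less_trans)
    qed (auto simp: a_def)
    with mc show ?thesis by (simp add: mcomplete_def)
  qed
  define g where "g y = (if y \<in> Conv then (SOME l. limitin mtopology (\<lambda>n. a n y) l sequentially) else x 0)" for y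
  have g_lim: "limitin mtopology (\<lambda>n. a n y) (g y) sequentially" if "y \<in> Conv" for y
    using someI_ex[OF Conv[OF that]] that by (simp add: g_def)
  have g_in: "g y \<in> space M" for y
    using g_lim[of y] by (cases "y \<in> Conv") (auto simp: limitin_metric g_def)
  have g_out: "g y = x 0" if "y \<notin> Conv" for y using that by (simp add: g_def)
  have near: "\<exists>N. \<forall>n\<ge>N. d (a n y) (g y) < e" if "y \<in> Conv" "e > 0" for y e
    using g_lim[OF that(1)] that(2) unfolding limitin_metric eventually_sequentially by blast
  have "g \<in> Y \<rightarrow>\<^sub>M M"
  proof (rule measurable_sigma_sets[OF setsM])
    show "{W. openin mtopology W} \<subseteq> Pow (space M)" using openin_subset by fastforce
    show "g \<in> space Y \<rightarrow> space M" using g_in by simp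
    fix W assume "W \<in> {W. openin mtopology W}"
    then have W: "openin mtopology W" by simp
    \<comment> \<open>Membership of the limit in an open set becomes a countable condition on the
      indices \<open>i n y\<close>: balls of one fixed radius about all late approximants lie in
      \<open>W\<close>.\<close>
    have iff: "g y \<in> W \<longleftrightarrow> (\<exists>k N. \<forall>n\<ge>N. mball (a n y) (r k) \<subseteq> W)" if y: "y \<in> Conv" for y
    proof
      assume "g y \<in> W"
      then obtain e where e: "e > 0" "mball (g y) e \<subseteq> W" using W by (auto simp: openin_mtopology)
      obtain k where k: "r k < e / 2" using ex_r[of "e/2"] e by auto
      obtain N where N: "\<And>n. n \<ge> N \<Longrightarrow> d (a n y) (g y) < e / 2"
        using near[OF y, of "e / 2"] e(1) by auto
      have "mball (a n y) (r k) \<subseteq> W" if "n \<ge> N" for n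
      proof
        fix z assume z: "z \<in> mball (a n y) (r k)"
        then have zM: "z \<in> space M" "a n y \<in> space M" "d (a n y) z < r k" by (auto simp: in_mball)
        have "d (g y) z \<le> d (g y) (a n y) + d (a n y) z" using zM g_in by (intro triangle) auto
        also have "\<dots> < e" using N[OF that] zM(3) k by (simp add: commute)
        finally show "z \<in> W" using e zM g_in by (auto simp: in_mball)
      qed
      then show "\<exists>k N. \<forall>n\<ge>N. mball (a n y) (r k) \<subseteq> W" by blast
    next
      assume "\<exists>k N. \<forall>n\<ge>N. mball (a n y) (r k) \<subseteq> W"
      then obtain k N where kN: "\<And>n. n \<ge> N \<Longrightarrow> mball (a n y) (r k) \<subseteq> W" by blast
      obtain N' where N': "\<And>n. n \<ge> N' \<Longrightarrow> d (a n y) (g y) < r k"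
        using near[OF y r[of k]] by auto
      have "g y \<in> mball (a (max N N') y) (r k)"
        using N'[of "max N N'"] g_in by (auto simp: in_mball a_def)
      with kN[of "max N N'"] show "g y \<in> W" by auto
    qed
    have [measurable]: "Measurable.pred Y (\<lambda>y. mball (a n y) (r k) \<subseteq> W)" for n k
      unfolding a_def
      by (rule measurable_compose[OF im]) simp
    have "g -` W \<inter> space Y = {y\<in>space Y. (y \<in> Conv \<and> (\<exists>k N. \<forall>n\<ge>N. mball (a n y) (r k) \<subseteq> W)) \<or> (y \<notin> Conv \<and> x 0 \<in> W)}"
    proof (rule Set.set_eqI)
      fix y
      show "y \<in> g -` W \<inter> space Y \<longleftrightarrow> y \<in> {y\<in>space Y. (y \<in> Conv \<and> (\<exists>k N. \<forall>n\<ge>N. mball (a n y) (r k) \<subseteq> W)) \<or> (y \<notin> Conv \<and> x 0 \<in> W)}"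
        using iff[of y] g_out[of y] by (cases "y \<in> Conv") (simp_all add: conj_commute)
    qed
    also have "\<dots> \<in> sets Y" by measurable
    finally show "g -` W \<inter> space Y \<in> sets Y" .
  qed
  moreover have "AE s in M. g (U s) = s"
  proof -
    \<comment> \<open>There are countably many balls, so one null set serves all. Off it
      \<open>a n (U s)\<close> is within \<open>r n\<close> of \<open>s\<close>, and the limit
      defining \<open>g (U s)\<close> is \<open>s\<close>.\<close>
    have "AE s in M. \<forall>n j. s \<in> mball (x j) (r n) \<longleftrightarrow> U s \<in> D n j"
      using AED by (simp add: AE_all_countable)
    then show ?thesis
    proof (rule AE_mp, intro AE_I2 impI)
      fix s assume s: "s \<in> space M" and eq: "\<forall>n j. s \<in> mball (x j) (r n) \<longleftrightarrow> U s \<in> D n j"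
      have UY: "U s \<in> space Y" using s by (rule measurable_space[rotated]) simp
      have d: "d (a n (U s)) s < r n" for n
      proof -
        obtain j where "d (x j) s < r n" using dense[OF s r] by blast
        then have "U s \<in> D n j" using eq s by (auto simp: in_mball)
        then have "U s \<in> D n (i n (U s))" unfolding i_def by (rule LeastI)
        then have "s \<in> mball (a n (U s)) (r n)" using eq by (simp add: a_def)
        then show ?thesis by (simp add: in_mball)
      qed
      have lim: "limitin mtopology (\<lambda>n. a n (U s)) s sequentially"
        unfolding limitin_metric
      proof (intro conjI allI impI s)
        fix e :: real assume "e > 0"
        then obtain k where k: "r k < e" using ex_r by blast
        have "d (a n (U s)) s < e" if "n \<ge> k" for n
        proof -
          have "r n \<le> r k" unfolding r_def using that by (intro le_imp_inverse_le) auto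
          with d[of n] k show ?thesis by linarith
        qed
        then show "\<forall>\<^sub>F n in sequentially. a n (U s) \<in> space M \<and> d (a n (U s)) s < e"
          by (auto simp: eventually_sequentially a_def)
      qed
      have "MCauchy (\<lambda>n. a n (U s))"
        by (rule convergent_imp_MCauchy[OF _ lim]) (auto simp: a_def)
      then have "\<exists>N. \<forall>m\<ge>N. \<forall>n\<ge>N. d (a m (U s)) (a n (U s)) < r k" for k
        using r[of k] unfolding MCauchy_def by meson
      then have "U s \<in> Conv"
        using UY by (simp add: Conv_def)
      from limitin_metric_unique[OF g_lim[OF this] lim] show "g (U s) = s" by simp
    qed
  qed
  ultimately show ?thesis by blast
qed

section \<open>Nonsingular actions and transport of triplets\<close>

lemma AE_compose_ac:
  assumes T: "T \<in> M \<rightarrow>\<^sub>M N" and ac: "absolutely_continuous N (distr M N T)" and P: "AE y in N. P y"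
  shows "AE s in M. P (T s)"
proof -
  have "AE y in distr M N T. P y"
    by (rule absolutely_continuous_AE[OF _ ac P]) simp
  then show ?thesis by (rule AE_distrD[OF T])
qed

text \<open>Almost everywhere \<open>g s = g (T (T' s))\<close>, so the density is a function of the
  image point.\<close>

lemma distr_density_inverse:
  assumes [measurable]: "T' \<in> M \<rightarrow>\<^sub>M N" "T \<in> N \<rightarrow>\<^sub>M M" "g \<in> borel_measurable M"
    and inv: "AE s in M. T (T' s) = s"
  shows "distr (density M g) N T' = density (distr M N T') (\<lambda>y. g (T y))"
proof (rule measure_eqI)
  fix A assume "A \<in> sets (distr (density M g) N T')"
  then have [measurable]: "A \<in> sets N" by simp
  have "emeasure (distr (density M g) N T') A = (\<integral>\<^sup>+s. g s * indicator (T' -` A \<inter> space M) s \<partial>M)"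
    by (simp add: emeasure_distr emeasure_density)
  also have "\<dots> = (\<integral>\<^sup>+s. g (T (T' s)) * indicator A (T' s) \<partial>M)"
    using inv by (intro nn_integral_cong_AE) (auto split: split_indicator)
  also have "\<dots> = emeasure (density (distr M N T') (\<lambda>y. g (T y))) A"
    by (simp add: emeasure_density nn_integral_distr)
  finally show "emeasure (distr (density M g) N T') A = emeasure (density (distr M N T') (\<lambda>y. g (T y))) A" .
qed simp

text \<open>Images of sigma-finite measures need not be sigma-finite. Here a cover of
  \<open>M\<close> is pulled back by \<open>T\<close>, and its pieces keep their mass because
  \<open>T\<close> inverts \<open>T'\<close> almost everywhere.\<close>

lemma sigma_finite_measure_distr_inverse:
  assumes M: "sigma_finite_measure M" and [measurable]: "T' \<in> M \<rightarrow>\<^sub>M N" "T \<in> N \<rightarrow>\<^sub>M M"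
    and inv: "AE s in M. T (T' s) = s"
  shows "sigma_finite_measure (distr M N T')"
proof -
  interpret sigma_finite_measure M by fact
  obtain A where A: "countable A" "A \<subseteq> sets M" "\<Union>A = space M" "\<And>a. a \<in> A \<Longrightarrow> emeasure M a \<noteq> \<infinity>"
    using sigma_finite_countable by (metis subset_iff)
  let ?B = "(\<lambda>a. T -` a \<inter> space N) ` A"
  show ?thesis
  proof (intro sigma_finite_measure.intro exI[of _ ?B] conjI ballI)
    show "countable ?B" using A by simp
    show "?B \<subseteq> sets (distr M N T')" using A by (auto intro!: measurable_sets[of T N M])
    show "\<Union>?B = space (distr M N T')"
    proof -
      have "\<Union>?B = T -` (\<Union>A) \<inter> space N" by auto
      then show ?thesis using A(3) measurable_space[of T N M] by auto
    qed
    fix b assume "b \<in> ?B"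
    then obtain a where a: "a \<in> A" "b = T -` a \<inter> space N" by auto
    then have [measurable]: "a \<in> sets M" using A by auto
    have "emeasure (distr M N T') b = emeasure M (T' -` b \<inter> space M)"
      unfolding a by (subst emeasure_distr) auto
    also have "\<dots> = emeasure M a"
    proof (rule emeasure_eq_AE)
      show "AE s in M. s \<in> T' -` b \<inter> space M \<longleftrightarrow> s \<in> a"
        using inv AE_space by eventually_elim (simp add: a measurable_space[of T' M N])
    qed (simp_all add: a)
    finally show "emeasure (distr M N T') b \<noteq> \<infinity>" using A(4)[OF a(1)] by simp
  qed
qed

lemma equiv_measure_RN_deriv:
  assumes "sigma_finite_measure M" "sigma_finite_measure N" "equiv_measure N M"
  shows "density M (RN_deriv M N) = N"
    and "AE s in M. RN_deriv M N s \<noteq> 0"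
    and "AE s in M. RN_deriv M N s \<noteq> \<infinity>"
proof -
  interpret M: sigma_finite_measure M by fact
  have s: "sets N = sets M" and ac: "absolutely_continuous M N" "absolutely_continuous N M"
    using assms(3) by (auto simp: equiv_measure_def)
  show d: "density M (RN_deriv M N) = N" by (rule M.density_RN_deriv[OF ac(1) s])
  show "AE s in M. RN_deriv M N s \<noteq> \<infinity>" by (rule M.RN_deriv_finite[OF assms(2) ac(1) s])
  \<comment> \<open>The zero set of the derivative is null for \<open>N\<close>, hence for
    \<open>M\<close> by equivalence.\<close>
  have "AE s in density M (RN_deriv M N). RN_deriv M N s \<noteq> 0"
    by (subst AE_density) (auto)
  then have "AE s in N. RN_deriv M N s \<noteq> 0" by (simp only: d)
  then show "AE s in M. RN_deriv M N s \<noteq> 0"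
    by (rule absolutely_continuous_AE[OF s[symmetric] ac(2)])
qed

section \<open>The Radon-Nikodym cocycle of a nonsingular action\<close>

locale ns_action = group G for G :: "('g, 'm) monoid_scheme" (structure) +
  fixes M :: "'a measure" and \<phi> :: "'g \<Rightarrow> 'a \<Rightarrow> 'a"
  assumes nonsingular: "nonsingular_action G M \<phi>"
begin

lemma phi_measurable [measurable]: "t \<in> carrier G \<Longrightarrow> \<phi> t \<in> M \<rightarrow>\<^sub>M M"
  using nonsingular by (simp add: nonsingular_action_def)

sublocale sigma_finite_measure M
  using nonsingular by (simp add: nonsingular_action_def standard_measure_space_def)

lemma phi_mult: "u \<in> carrier G \<Longrightarrow> v \<in> carrier G \<Longrightarrow> AE s in M. \<phi> (u \<otimes> v) s = \<phi> v (\<phi> u s)"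
  and phi_one: "AE s in M. \<phi> \<one> s = s"
  using nonsingular by (auto simp: nonsingular_action_def)

lemma phi_inv: assumes "t \<in> carrier G"
  shows "AE s in M. \<phi> t (\<phi> (inv t) s) = s" "AE s in M. \<phi> (inv t) (\<phi> t s) = s"
proof -
  show "AE s in M. \<phi> t (\<phi> (inv t) s) = s"
    using phi_mult[OF inv_closed[OF assms] assms] phi_one by eventually_elim (simp add: assms)
  show "AE s in M. \<phi> (inv t) (\<phi> t s) = s"
    using phi_mult[OF assms inv_closed[OF assms]] phi_one by eventually_elim (simp add: assms)
qed

lemma equiv_translated: "t \<in> carrier G \<Longrightarrow> equiv_measure (translated_measure G M \<phi> t) M"
  using nonsingular by (auto simp: nonsingular_action_def)

lemma AE_phi:
  assumes "t \<in> carrier G" "AE s in M. P s"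
  shows "AE s in M. P (\<phi> t s)"
proof (rule AE_compose_ac[where P=P, OF _ _ assms(2)])
  \<comment> \<open>The translated measure at \<open>inv t\<close> is the image of \<open>M\<close>
    under \<open>\<phi> t\<close> itself.\<close>
  show "absolutely_continuous M (distr M M (\<phi> t))"
    using equiv_translated[of "inv t"] assms(1) by (simp add: translated_measure_def equiv_measure_def)
qed (simp add: assms)

definition w :: "'g \<Rightarrow> 'a \<Rightarrow> ennreal" where
  "w t = RN_deriv M (translated_measure G M \<phi> t)"

lemma w_measurable [measurable]: "w t \<in> borel_measurable M"
  by (simp add: w_def)

lemma sigma_finite_translated: "t \<in> carrier G \<Longrightarrow> sigma_finite_measure (translated_measure G M \<phi> t)"
  unfolding translated_measure_def
  by (rule sigma_finite_measure_distr_inverse[where T="\<phi> t"]) (auto intro: sigma_finite_measure_axioms phi_inv)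

lemma density_w: "t \<in> carrier G \<Longrightarrow> density M (w t) = distr M M (\<phi> (inv t))"
  and w_nonzero: "t \<in> carrier G \<Longrightarrow> AE s in M. w t s \<noteq> 0"
  and w_finite: "t \<in> carrier G \<Longrightarrow> AE s in M. w t s \<noteq> \<infinity>"
  using equiv_measure_RN_deriv[OF sigma_finite_measure_axioms sigma_finite_translated equiv_translated, of t]
  unfolding w_def translated_measure_def by simp_all

text \<open>Both sides are densities of the image of \<open>M\<close> under
  \<open>\<phi> (inv v \<otimes> inv t)\<close>, computed in one and in two steps; densities over a
  sigma-finite measure are unique.\<close>

lemma w_chain:
  assumes [simp]: "t \<in> carrier G" "v \<in> carrier G"
  shows "AE s in M. w (t \<otimes> v) s = w t s * w v (\<phi> t s)"
proof (rule density_unique)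
  have "density M (w (t \<otimes> v)) = distr M M (\<phi> (inv v \<otimes> inv t))"
    by (simp add: density_w inv_mult_group)
  also have "\<dots> = distr M M (\<phi> (inv t) \<circ> \<phi> (inv v))"
    using phi_mult[of "inv v" "inv t"] by (intro distr_cong_AE) auto
  also have "\<dots> = distr (distr M M (\<phi> (inv v))) M (\<phi> (inv t))"
    by (rule distr_distr[symmetric]) auto
  also have "\<dots> = distr (density M (w v)) M (\<phi> (inv t))"
    by (simp add: density_w)
  also have "\<dots> = density (distr M M (\<phi> (inv t))) (\<lambda>s. w v (\<phi> t s))"
    by (rule distr_density_inverse) (auto intro: phi_inv)
  also have "\<dots> = density (density M (w t)) (\<lambda>s. w v (\<phi> t s))"
    by (simp add: density_w)
  also have "\<dots> = density M (\<lambda>s. w t s * w v (\<phi> t s))"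
    by (rule density_density_eq) auto
  finally show "density M (w (t \<otimes> v)) = density M (\<lambda>s. w t s * w v (\<phi> t s))" .
qed auto

lemma triplet_family_w: "triplet_family \<alpha> G M f \<phi> c t s = c t s * enn2real (w t s) powr (1 / \<alpha>) * f (\<phi> t s)"
  by (simp add: triplet_family_def w_def)

text \<open>Sign, derivative and composition are each multiplicative along the action. One null set
  serves all \<open>v\<close> by countability.\<close>

lemma triplet_family_mult:
  assumes c: "sign_cocycle G M \<phi> c" and t: "t \<in> carrier G" and G: "countable (carrier G)"
  shows "AE s in M. \<forall>v\<in>carrier G. triplet_family \<alpha> G M f \<phi> c (t \<otimes> v) s
     = c t s * enn2real (w t s) powr (1 / \<alpha>) * triplet_family \<alpha> G M f \<phi> c v (\<phi> t s)"
proof (rule AE_ball_countable'[OF _ G])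
  fix v assume v: "v \<in> carrier G"
  have "AE s in M. c (t \<otimes> v) s = c t s * c v (\<phi> t s)"
    using c t v by (simp add: sign_cocycle_def)
  with w_chain[OF t v] phi_mult[OF t v]
  show "AE s in M. triplet_family \<alpha> G M f \<phi> c (t \<otimes> v) s
     = c t s * enn2real (w t s) powr (1 / \<alpha>) * triplet_family \<alpha> G M f \<phi> c v (\<phi> t s)"
    by eventually_elim (simp add: triplet_family_w enn2real_mult powr_mult)
qed

end

text \<open>Conjugacy asks for nonsingularity of \<open>h\<close> only. That of \<open>h'\<close>
  follows because taking preimages under both maps in turn changes a set only by a null set.\<close>

lemma conjugate_via_equiv_inverse:
  assumes "conjugate_via G M\<^sub>1 \<phi>\<^sub>1 M\<^sub>2 \<phi>\<^sub>2 h h'"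
  shows "equiv_measure (distr M\<^sub>2 M\<^sub>1 h') M\<^sub>1"
proof -
  have [measurable]: "h \<in> M\<^sub>1 \<rightarrow>\<^sub>M M\<^sub>2" "h' \<in> M\<^sub>2 \<rightarrow>\<^sub>M M\<^sub>1" and inv: "AE s in M\<^sub>1. h' (h s) = s"
    and e: "equiv_measure (distr M\<^sub>1 M\<^sub>2 h) M\<^sub>2"
    using assms by (auto simp: conjugate_via_def)
  have "emeasure (distr M\<^sub>2 M\<^sub>1 h') A = 0 \<longleftrightarrow> emeasure M\<^sub>1 A = 0" if [measurable]: "A \<in> sets M\<^sub>1" for A
  proof -
    let ?B = "h' -` A \<inter> space M\<^sub>2"
    have "emeasure (distr M\<^sub>2 M\<^sub>1 h') A = 0 \<longleftrightarrow> ?B \<in> null_sets M\<^sub>2"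
      by (simp add: emeasure_distr null_sets_def)
    also have "\<dots> \<longleftrightarrow> ?B \<in> null_sets (distr M\<^sub>1 M\<^sub>2 h)"
      using e by (auto simp: equiv_measure_def absolutely_continuous_def)
    also have "\<dots> \<longleftrightarrow> emeasure M\<^sub>1 (h -` ?B \<inter> space M\<^sub>1) = 0"
      by (simp add: null_sets_def emeasure_distr)
    also have "emeasure M\<^sub>1 (h -` ?B \<inter> space M\<^sub>1) = emeasure M\<^sub>1 A"
    proof (rule emeasure_eq_AE)
      show "AE s in M\<^sub>1. s \<in> h -` ?B \<inter> space M\<^sub>1 \<longleftrightarrow> s \<in> A"
        using inv AE_space by eventually_elim (simp add: measurable_space[of h M\<^sub>1 M\<^sub>2])
    qed simp_all
    finally show ?thesis .
  qed
  then have "null_sets (distr M\<^sub>2 M\<^sub>1 h') = null_sets M\<^sub>1"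
    by (intro Set.set_eqI) (simp add: null_sets_def, blast)
  then show ?thesis
    by (simp add: equiv_measure_def absolutely_continuous_def)
qed

section \<open>Transport of integrals, families and minimality along a conjugacy\<close>

locale conjugated_actions = A\<^sub>1: ns_action G M\<^sub>1 \<phi>\<^sub>1 + A\<^sub>2: ns_action G M\<^sub>2 \<phi>\<^sub>2
  for G :: "('g, 'm) monoid_scheme" (structure) and M\<^sub>1 :: "'a measure" and \<phi>\<^sub>1 and M\<^sub>2 :: "'b measure" and \<phi>\<^sub>2 +
  fixes h :: "'a \<Rightarrow> 'b" and h' :: "'b \<Rightarrow> 'a"
  assumes conj: "conjugate_via G M\<^sub>1 \<phi>\<^sub>1 M\<^sub>2 \<phi>\<^sub>2 h h'"
begin

lemma h_measurable [measurable]: "h \<in> M\<^sub>1 \<rightarrow>\<^sub>M M\<^sub>2" "h' \<in> M\<^sub>2 \<rightarrow>\<^sub>M M\<^sub>1"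
  and h_inv: "AE s in M\<^sub>1. h' (h s) = s" "AE s in M\<^sub>2. h (h' s) = s"
  and equiv_h: "equiv_measure (distr M\<^sub>1 M\<^sub>2 h) M\<^sub>2"
  and h_phi: "t \<in> carrier G \<Longrightarrow> AE s in M\<^sub>1. h (\<phi>\<^sub>1 t s) = \<phi>\<^sub>2 t (h s)"
  using conj by (simp_all add: conjugate_via_def)

lemma AE_h': "AE s in M\<^sub>1. P s \<Longrightarrow> AE s in M\<^sub>2. P (h' s)"
  using conjugate_via_equiv_inverse[OF conj]
  by (rule_tac AE_compose_ac[where P=P and N=M\<^sub>1]) (simp_all add: equiv_measure_def)

lemma h'_phi: assumes "t \<in> carrier G" shows "AE s in M\<^sub>2. h' (\<phi>\<^sub>2 t s) = \<phi>\<^sub>1 t (h' s)"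
  using AE_h'[OF h_phi[OF assms]] AE_h'[OF A\<^sub>1.AE_phi[OF assms h_inv(1)]] h_inv(2)
  by eventually_elim simp

definition rho :: "'b \<Rightarrow> ennreal" where
  "rho = RN_deriv M\<^sub>2 (distr M\<^sub>1 M\<^sub>2 h)"

lemma rho_measurable [measurable]: "rho \<in> borel_measurable M\<^sub>2"
  by (simp add: rho_def)

lemma density_rho: "density M\<^sub>2 rho = distr M\<^sub>1 M\<^sub>2 h"
  and rho_nonzero: "AE s in M\<^sub>2. rho s \<noteq> 0"
  and rho_finite: "AE s in M\<^sub>2. rho s \<noteq> \<infinity>"
  using equiv_measure_RN_deriv[OF A\<^sub>2.sigma_finite_measure_axioms
    sigma_finite_measure_distr_inverse[OF A\<^sub>1.sigma_finite_measure_axioms h_measurable h_inv(1)] equiv_h]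
  unfolding rho_def by simp_all

text \<open>Both sides are densities of the image of \<open>M\<^sub>1\<close> under
  \<open>\<phi>\<^sub>2 (inv t) \<circ> h\<close>, which agrees almost everywhere with
  \<open>h \<circ> \<phi>\<^sub>1 (inv t)\<close>.\<close>

lemma w_rho:
  assumes t [simp]: "t \<in> carrier G"
  shows "AE s in M\<^sub>2. A\<^sub>2.w t s * rho (\<phi>\<^sub>2 t s) = rho s * A\<^sub>1.w t (h' s)"
proof (rule A\<^sub>2.density_unique)
  have i [simp]: "inv t \<in> carrier G" by simp
  have "density M\<^sub>2 (\<lambda>s. A\<^sub>2.w t s * rho (\<phi>\<^sub>2 t s)) = density (density M\<^sub>2 (A\<^sub>2.w t)) (\<lambda>s. rho (\<phi>\<^sub>2 t s))"
    by (rule density_density_eq[symmetric]) auto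
  also have "\<dots> = density (distr M\<^sub>2 M\<^sub>2 (\<phi>\<^sub>2 (inv t))) (\<lambda>s. rho (\<phi>\<^sub>2 t s))"
    by (simp add: A\<^sub>2.density_w)
  also have "\<dots> = distr (density M\<^sub>2 rho) M\<^sub>2 (\<phi>\<^sub>2 (inv t))"
    by (rule distr_density_inverse[symmetric]) (auto intro: A\<^sub>2.phi_inv)
  also have "\<dots> = distr (distr M\<^sub>1 M\<^sub>2 h) M\<^sub>2 (\<phi>\<^sub>2 (inv t))"
    by (simp add: density_rho)
  also have "\<dots> = distr M\<^sub>1 M\<^sub>2 (\<phi>\<^sub>2 (inv t) \<circ> h)"
    by (rule distr_distr) auto
  also have "\<dots> = distr M\<^sub>1 M\<^sub>2 (h \<circ> \<phi>\<^sub>1 (inv t))"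
  proof (rule distr_cong_AE)
    show "AE s in M\<^sub>1. (\<phi>\<^sub>2 (inv t) \<circ> h) s = (h \<circ> \<phi>\<^sub>1 (inv t)) s"
      using h_phi[OF i] by eventually_elim simp
  qed auto
  also have "\<dots> = distr (distr M\<^sub>1 M\<^sub>1 (\<phi>\<^sub>1 (inv t))) M\<^sub>2 h"
    by (rule distr_distr[symmetric]) auto
  also have "\<dots> = distr (density M\<^sub>1 (A\<^sub>1.w t)) M\<^sub>2 h"
    by (simp add: A\<^sub>1.density_w)
  also have "\<dots> = density (distr M\<^sub>1 M\<^sub>2 h) (\<lambda>s. A\<^sub>1.w t (h' s))"
    by (rule distr_density_inverse) (auto intro: h_inv)
  also have "\<dots> = density M\<^sub>2 (\<lambda>s. rho s * A\<^sub>1.w t (h' s))"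
    by (simp add: density_rho[symmetric] density_density_eq)
  finally show "density M\<^sub>2 (\<lambda>s. A\<^sub>2.w t s * rho (\<phi>\<^sub>2 t s)) = density M\<^sub>2 (\<lambda>s. rho s * A\<^sub>1.w t (h' s))" .
qed (use t in auto)

lemma density_rho_real: "density M\<^sub>2 (\<lambda>s. ennreal (enn2real (rho s))) = distr M\<^sub>1 M\<^sub>2 h"
proof -
  have "density M\<^sub>2 (\<lambda>s. ennreal (enn2real (rho s))) = density M\<^sub>2 rho"
  proof (rule density_cong)
    show "AE s in M\<^sub>2. ennreal (enn2real (rho s)) = rho s"
      using rho_finite by eventually_elim (simp add: less_top)
  qed auto
  then show ?thesis by (simp add: density_rho)
qed

lemma transport_has_integral:
  fixes k :: "'a \<Rightarrow> real"
  assumes k: "has_bochner_integral M\<^sub>1 k z"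
  shows "has_bochner_integral M\<^sub>2 (\<lambda>s. enn2real (rho s) * k (h' s)) z"
proof -
  have [measurable]: "k \<in> borel_measurable M\<^sub>1" using k by (simp add: has_bochner_integral_iff borel_measurable_integrable)
  have "has_bochner_integral M\<^sub>1 (\<lambda>s. k (h' (h s))) z"
  proof (rule has_bochner_integral_cong_AE[THEN iffD1, OF _ _ _ k])
    show "AE s in M\<^sub>1. k s = k (h' (h s))"
      using h_inv(1) by eventually_elim simp
  qed auto
  then have "has_bochner_integral (distr M\<^sub>1 M\<^sub>2 h) (\<lambda>s. k (h' s)) z"
    by (intro has_bochner_integral_distr) auto
  then show ?thesis
    unfolding density_rho_real[symmetric] has_bochner_integral_iff
    by (simp add: integrable_density integral_density)
qed

text \<open>The factor between a transported family and the original one; it is the same for every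
  group element.\<close>

definition scaling :: "real \<Rightarrow> ('b \<Rightarrow> real) \<Rightarrow> 'b \<Rightarrow> real" where
  "scaling \<alpha> b s = b s * enn2real (rho s) powr (1 / \<alpha>)"

lemma scaling_measurable [measurable]: "b \<in> borel_measurable M\<^sub>2 \<Longrightarrow> (\<lambda>s. scaling \<alpha> b s) \<in> borel_measurable M\<^sub>2"
  unfolding scaling_def by (intro borel_measurable_times powr_real_measurable borel_measurable_const borel_measurable_enn2real rho_measurable)

text \<open>The absolute value of \<open>scaling\<close>, raised to the power \<alpha>, is
  \<open>rho\<close>, the density in the change of variables; the transport is therefore isometric
  on L^alpha.\<close>

lemma transport_scale:
  assumes "0 < \<alpha>" and b: "sign_map M\<^sub>2 b" and [measurable]: "k \<in> borel_measurable M\<^sub>1" "k' \<in> borel_measurable M\<^sub>2"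
    and k': "AE s in M\<^sub>2. k' s = scaling \<alpha> b s * k (h' s)"
    and k: "integrable M\<^sub>1 (\<lambda>s. \<bar>k s\<bar> powr \<alpha>)"
  shows "integrable M\<^sub>2 (\<lambda>s. \<bar>k' s\<bar> powr \<alpha>)"
    and "(LINT s|M\<^sub>2. \<bar>k' s\<bar> powr \<alpha>) = (LINT s|M\<^sub>1. \<bar>k s\<bar> powr \<alpha>)"
proof -
  have [measurable]: "b \<in> borel_measurable M\<^sub>2" using b by (simp add: sign_map_def)
  have 1: "has_bochner_integral M\<^sub>2 (\<lambda>s. enn2real (rho s) * \<bar>k (h' s)\<bar> powr \<alpha>) (LINT s|M\<^sub>1. \<bar>k s\<bar> powr \<alpha>)"
    using k by (intro transport_has_integral) (simp add: has_bochner_integral_iff)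
  have "has_bochner_integral M\<^sub>2 (\<lambda>s. \<bar>k' s\<bar> powr \<alpha>) (LINT s|M\<^sub>1. \<bar>k s\<bar> powr \<alpha>)"
  proof (rule has_bochner_integral_cong_AE[THEN iffD1, OF _ _ _ 1])
    show "AE s in M\<^sub>2. enn2real (rho s) * \<bar>k (h' s)\<bar> powr \<alpha> = \<bar>k' s\<bar> powr \<alpha>"
      using k' AE_space
    proof eventually_elim
      case (elim s)
      have "b s = 1 \<or> b s = -1" using b elim by (auto simp: sign_map_def)
      then have "\<bar>k' s\<bar> = enn2real (rho s) powr (1 / \<alpha>) * \<bar>k (h' s)\<bar>"
        unfolding elim(1) scaling_def by (auto simp: abs_mult)
      then show ?case using \<open>0 < \<alpha>\<close> by (simp add: powr_mult powr_powr)
    qed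
  qed auto
  then show "integrable M\<^sub>2 (\<lambda>s. \<bar>k' s\<bar> powr \<alpha>)"
    and "(LINT s|M\<^sub>2. \<bar>k' s\<bar> powr \<alpha>) = (LINT s|M\<^sub>1. \<bar>k s\<bar> powr \<alpha>)"
    by (auto simp: has_bochner_integral_iff)
qed

lemma scaling_nonzero:
  assumes "sign_map M\<^sub>2 b"
  shows "AE s in M\<^sub>2. scaling \<alpha> b s \<noteq> 0"
  using rho_nonzero rho_finite AE_space
proof eventually_elim
  case (elim s)
  then have "b s \<noteq> 0" using assms by (auto simp: sign_map_def)
  moreover have "enn2real (rho s) \<noteq> 0" using elim by (auto simp: enn2real_eq_0_iff)
  ultimately show ?case by (simp add: scaling_def)
qed

text \<open>The cocycle relation moves \<open>b\<close> from \<open>\<phi>\<^sub>2 t s\<close> back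
  to \<open>s\<close>, and \<open>w_rho\<close> does the same for \<open>rho\<close>. What remains
  in front does not depend on \<open>t\<close>.\<close>

lemma transported_triplet_family:
  fixes f\<^sub>1 :: "'a \<Rightarrow> real"
  assumes b: "sign_map M\<^sub>2 b" and t: "t \<in> carrier G"
    and cb: "AE s in M\<^sub>2. c\<^sub>1 t (h' s) = c\<^sub>2 t s * (b (\<phi>\<^sub>2 t s) / b s)"
  shows "AE s in M\<^sub>2. triplet_family \<alpha> G M\<^sub>2 (transported_function \<alpha> M\<^sub>1 M\<^sub>2 f\<^sub>1 h h' b) \<phi>\<^sub>2 c\<^sub>2 t s
     = scaling \<alpha> b s * triplet_family \<alpha> G M\<^sub>1 f\<^sub>1 \<phi>\<^sub>1 c\<^sub>1 t (h' s)"
  using cb w_rho[OF t] h'_phi[OF t] AE_space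
proof eventually_elim
  case (elim s)
  have "b s \<noteq> 0" using b elim by (auto simp: sign_map_def)
  then have c: "c\<^sub>2 t s * b (\<phi>\<^sub>2 t s) = b s * c\<^sub>1 t (h' s)" using elim(1) by simp
  have "enn2real (A\<^sub>2.w t s) * enn2real (rho (\<phi>\<^sub>2 t s)) = enn2real (rho s) * enn2real (A\<^sub>1.w t (h' s))"
    using arg_cong[OF elim(2), of enn2real] by (simp add: enn2real_mult)
  then have p: "enn2real (A\<^sub>2.w t s) powr (1/\<alpha>) * enn2real (rho (\<phi>\<^sub>2 t s)) powr (1/\<alpha>) = enn2real (rho s) powr (1/\<alpha>) * enn2real (A\<^sub>1.w t (h' s)) powr (1/\<alpha>)"
    by (simp add: powr_mult[symmetric])
  have "triplet_family \<alpha> G M\<^sub>2 (transported_function \<alpha> M\<^sub>1 M\<^sub>2 f\<^sub>1 h h' b) \<phi>\<^sub>2 c\<^sub>2 t s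
    = (c\<^sub>2 t s * b (\<phi>\<^sub>2 t s)) * (enn2real (A\<^sub>2.w t s) powr (1/\<alpha>) * enn2real (rho (\<phi>\<^sub>2 t s)) powr (1/\<alpha>)) * f\<^sub>1 (h' (\<phi>\<^sub>2 t s))"
    by (simp add: A\<^sub>2.triplet_family_w transported_function_def rho_def mult_ac)
  also have "\<dots> = scaling \<alpha> b s * triplet_family \<alpha> G M\<^sub>1 f\<^sub>1 \<phi>\<^sub>1 c\<^sub>1 t (h' s)"
    unfolding c p elim(3) by (simp add: A\<^sub>1.triplet_family_w scaling_def mult_ac)
  finally show ?case .
qed

text \<open>A common nonvanishing factor cancels in every ratio, infinite ones included, so the
  ratio sets of the two spaces correspond under \<open>h'\<close> modulo null sets.\<close>

lemma minimal_family_transport: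
  assumes min: "minimal_family G M\<^sub>1 f\<^sub>1" and z: "AE s in M\<^sub>2. z s \<noteq> (0::real)"
    and f1 [measurable]: "\<And>t. t \<in> carrier G \<Longrightarrow> f\<^sub>1 t \<in> borel_measurable M\<^sub>1"
    and f2 [measurable]: "\<And>t. t \<in> carrier G \<Longrightarrow> f\<^sub>2 t \<in> borel_measurable M\<^sub>2"
    and f: "\<And>t. t \<in> carrier G \<Longrightarrow> AE s in M\<^sub>2. f\<^sub>2 t s = z s * f\<^sub>1 t (h' s)"
  shows "minimal_family G M\<^sub>2 f\<^sub>2"
  unfolding minimal_family_def
proof
  have ext[measurable]: "(\<lambda>s. ext_ratio (p s) (q s)) \<in> borel_measurable M" if [measurable]: "p \<in> borel_measurable M" "q \<in> borel_measurable M" for p q and M :: "'c measure"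
    unfolding ext_ratio_def by measurable
  have sub: "A \<in> ratio_algebra G M\<^sub>2 f\<^sub>2 \<Longrightarrow> A \<in> sets M\<^sub>2" for A
  proof -
    have "ratio_algebra G M\<^sub>2 f\<^sub>2 \<subseteq> sets M\<^sub>2"
      unfolding ratio_algebra_def
    proof (rule sets.sigma_sets_subset, safe)
      fix t u and E :: "ereal set" assume "t \<in> carrier G" "u \<in> carrier G" "E \<in> sets borel"
      then show "(\<lambda>s. ext_ratio (f\<^sub>2 t s) (f\<^sub>2 u s)) -` E \<inter> space M\<^sub>2 \<in> sets M\<^sub>2"
        by (intro measurable_sets[OF ext] f2)
    qed
    then show "A \<in> ratio_algebra G M\<^sub>2 f\<^sub>2 \<Longrightarrow> A \<in> sets M\<^sub>2" by auto
  qed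
  \<comment> \<open>Induction along the generation of the sigma-algebra; the correspondence modulo
    null sets survives complements and countable unions.\<close>
  have tr: "\<exists>A'\<in>ratio_algebra G M\<^sub>2 f\<^sub>2. AE s in M\<^sub>2. s \<in> A' \<longleftrightarrow> h' s \<in> A" if "A \<in> ratio_algebra G M\<^sub>1 f\<^sub>1" for A
    using that unfolding ratio_algebra_def[of G M\<^sub>1]
  proof (induction A rule: sigma_sets.induct)
    case (Basic A)
    then obtain t u E where A: "A = (\<lambda>s. ext_ratio (f\<^sub>1 t s) (f\<^sub>1 u s)) -` E \<inter> space M\<^sub>1"
      and tu: "t \<in> carrier G" "u \<in> carrier G" and E: "E \<in> sets borel" by auto
    let ?A' = "(\<lambda>s. ext_ratio (f\<^sub>2 t s) (f\<^sub>2 u s)) -` E \<inter> space M\<^sub>2"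
    have "?A' \<in> ratio_algebra G M\<^sub>2 f\<^sub>2"
      unfolding ratio_algebra_def using tu E by (intro sigma_sets.Basic) blast
    moreover have "AE s in M\<^sub>2. s \<in> ?A' \<longleftrightarrow> h' s \<in> A"
      using f[OF tu(1)] f[OF tu(2)] z AE_space
      by eventually_elim (auto simp: A ext_ratio_def measurable_space[OF h_measurable(2)])
    ultimately show ?case by blast
  next
    case Empty
    show ?case by (rule bexI[of _ "{}"]) (auto simp: ratio_algebra_def sigma_sets.Empty)
  next
    case (Compl A)
    then obtain A' where A': "A' \<in> ratio_algebra G M\<^sub>2 f\<^sub>2" and e: "AE s in M\<^sub>2. s \<in> A' \<longleftrightarrow> h' s \<in> A" by blast
    show ?case
    proof (rule bexI[of _ "space M\<^sub>2 - A'"])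
      show "space M\<^sub>2 - A' \<in> ratio_algebra G M\<^sub>2 f\<^sub>2"
        using A' unfolding ratio_algebra_def by (rule sigma_sets.Compl)
      show "AE s in M\<^sub>2. s \<in> space M\<^sub>2 - A' \<longleftrightarrow> h' s \<in> space M\<^sub>1 - A"
        using e AE_space by eventually_elim (auto simp: measurable_space[OF h_measurable(2)])
    qed
  next
    case (Union A)
    then have "\<forall>i. \<exists>A'. A' \<in> ratio_algebra G M\<^sub>2 f\<^sub>2 \<and> (AE s in M\<^sub>2. s \<in> A' \<longleftrightarrow> h' s \<in> A i)" by blast
    then obtain A' where A': "\<And>i::nat. A' i \<in> ratio_algebra G M\<^sub>2 f\<^sub>2" and e: "\<And>i. AE s in M\<^sub>2. s \<in> A' i \<longleftrightarrow> h' s \<in> A i" by metis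
    show ?case
    proof (rule bexI[of _ "\<Union>i. A' i"])
      show "(\<Union>i. A' i) \<in> ratio_algebra G M\<^sub>2 f\<^sub>2"
        using A' unfolding ratio_algebra_def by (rule sigma_sets.Union)
      have "AE s in M\<^sub>2. \<forall>i. s \<in> A' i \<longleftrightarrow> h' s \<in> A i" using e by (simp add: AE_all_countable)
      then show "AE s in M\<^sub>2. s \<in> (\<Union>i. A' i) \<longleftrightarrow> h' s \<in> (\<Union>i. A i)"
        by eventually_elim auto
    qed
  qed
  \<comment> \<open>\<open>B\<close> is pulled back by \<open>h\<close>, approximated there by
    minimality, and the approximating set is carried over by \<open>tr\<close>.\<close>
  fix B assume [measurable]: "B \<in> sets M\<^sub>2"
  have "h -` B \<inter> space M\<^sub>1 \<in> sets M\<^sub>1" by measurable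
  then obtain A where A: "A \<in> ratio_algebra G M\<^sub>1 f\<^sub>1" "(A - (h -` B \<inter> space M\<^sub>1)) \<union> ((h -` B \<inter> space M\<^sub>1) - A) \<in> null_sets M\<^sub>1"
    using min unfolding minimal_family_def by blast
  obtain A' where A': "A' \<in> ratio_algebra G M\<^sub>2 f\<^sub>2" "AE s in M\<^sub>2. s \<in> A' \<longleftrightarrow> h' s \<in> A"
    using tr[OF A(1)] by blast
  have [measurable]: "A' \<in> sets M\<^sub>2" using A'(1) by (rule sub)
  have "AE s in M\<^sub>1. s \<notin> (A - (h -` B \<inter> space M\<^sub>1)) \<union> ((h -` B \<inter> space M\<^sub>1) - A)"
    by (rule AE_not_in[OF A(2)])
  from AE_h'[OF this] A'(2) h_inv(2) AE_space have "AE s in M\<^sub>2. s \<notin> (A' - B) \<union> (B - A')"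
    by eventually_elim (auto simp: measurable_space[OF h_measurable(2)])
  then have "(A' - B) \<union> (B - A') \<in> null_sets M\<^sub>2"
    by (subst AE_iff_null_sets) auto
  with A'(1) show "\<exists>A\<in>ratio_algebra G M\<^sub>2 f\<^sub>2. (A - B) \<union> (B - A) \<in> null_sets M\<^sub>2" by blast
qed

end

text \<open>Scale integrals of linear combinations are preserved by \<open>transport_scale\<close>,
  so the same field is represented. Full support persists because \<open>scaling\<close> is nonzero
  almost everywhere.\<close>

lemma approx_transports_triplet:
  fixes G :: "('g, 'm) monoid_scheme" and M\<^sub>1 :: "'a measure" and M\<^sub>2 :: "'b measure"
  assumes \<alpha>: "0 < \<alpha>" and "group G" and G: "countable (carrier G)"
    and R: "rosinski_triplet \<alpha> G P X M\<^sub>1 f\<^sub>1 \<phi>\<^sub>1 c\<^sub>1"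
    and na: "nonsingular_action G M\<^sub>2 \<phi>\<^sub>2" and sc: "sign_cocycle G M\<^sub>2 \<phi>\<^sub>2 c\<^sub>2"
    and ap: "approx_via G M\<^sub>1 \<phi>\<^sub>1 c\<^sub>1 M\<^sub>2 \<phi>\<^sub>2 c\<^sub>2 h h' b"
  defines "f\<^sub>2 \<equiv> transported_function \<alpha> M\<^sub>1 M\<^sub>2 f\<^sub>1 h h' b"
  shows "rosinski_triplet \<alpha> G P X M\<^sub>2 f\<^sub>2 \<phi>\<^sub>2 c\<^sub>2"
    and "minimal_family G M\<^sub>1 (triplet_family \<alpha> G M\<^sub>1 f\<^sub>1 \<phi>\<^sub>1 c\<^sub>1) \<Longrightarrow>
      minimal_family G M\<^sub>2 (triplet_family \<alpha> G M\<^sub>2 f\<^sub>2 \<phi>\<^sub>2 c\<^sub>2)"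
proof -
  interpret group G by fact
  interpret conjugated_actions G M\<^sub>1 \<phi>\<^sub>1 M\<^sub>2 \<phi>\<^sub>2 h h'
    by unfold_locales (use R na ap in \<open>auto simp: rosinski_triplet_def approx_via_def\<close>)
  have b: "sign_map M\<^sub>2 b" and cb: "\<And>t. t \<in> carrier G \<Longrightarrow> AE s in M\<^sub>2. c\<^sub>1 t (h' s) = c\<^sub>2 t s * (b (\<phi>\<^sub>2 t s) / b s)"
    using ap by (auto simp: approx_via_def)
  have [measurable]: "b \<in> borel_measurable M\<^sub>2" using b by (simp add: sign_map_def)
  have L1: "in_Lalpha \<alpha> M\<^sub>1 f\<^sub>1" and rep: "integral_representation \<alpha> G P X M\<^sub>1 (triplet_family \<alpha> G M\<^sub>1 f\<^sub>1 \<phi>\<^sub>1 c\<^sub>1)"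
    using R by (auto simp: rosinski_triplet_def)
  have [measurable]: "f\<^sub>1 \<in> borel_measurable M\<^sub>1" using L1 by (simp add: in_Lalpha_def)
  have f2s: "f\<^sub>2 s = scaling \<alpha> b s * f\<^sub>1 (h' s)" for s
    by (simp add: f\<^sub>2_def transported_function_def scaling_def rho_def)
  have [measurable]: "f\<^sub>2 \<in> borel_measurable M\<^sub>2" unfolding f2s by measurable
  have c2 [measurable]: "c\<^sub>2 t \<in> borel_measurable M\<^sub>2" if "t \<in> carrier G" for t
    using sc that by (simp add: sign_cocycle_def sign_map_def)
  let ?F1 = "triplet_family \<alpha> G M\<^sub>1 f\<^sub>1 \<phi>\<^sub>1 c\<^sub>1" and ?F2 = "triplet_family \<alpha> G M\<^sub>2 f\<^sub>2 \<phi>\<^sub>2 c\<^sub>2"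
  have F1L: "in_Lalpha \<alpha> M\<^sub>1 (?F1 t)" if "t \<in> carrier G" for t
    using rep that by (simp add: integral_representation_def)
  then have F1 [measurable]: "?F1 t \<in> borel_measurable M\<^sub>1" if "t \<in> carrier G" for t
    using that by (simp add: in_Lalpha_def)
  have F2 [measurable]: "?F2 t \<in> borel_measurable M\<^sub>2" if "t \<in> carrier G" for t
    unfolding A\<^sub>2.triplet_family_w using that by measurable
  have F: "AE s in M\<^sub>2. ?F2 t s = scaling \<alpha> b s * ?F1 t (h' s)" if "t \<in> carrier G" for t
    unfolding f\<^sub>2_def by (rule transported_triplet_family[where c\<^sub>1=c\<^sub>1 and c\<^sub>2=c\<^sub>2, OF b that cb[OF that]])
  have lin: "AE s in M\<^sub>2. (\<Sum>t\<in>F. a t * ?F2 t s) = scaling \<alpha> b s * (\<Sum>t\<in>F. a t * ?F1 t (h' s))"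
    if "finite F" "F \<subseteq> carrier G" for F a
  proof -
    have "AE s in M\<^sub>2. \<forall>t\<in>F. ?F2 t s = scaling \<alpha> b s * ?F1 t (h' s)"
      using that by (intro AE_finite_allI) (auto intro: F)
    then show ?thesis by eventually_elim (simp add: sum_distrib_left mult_ac)
  qed
  have "in_Lalpha \<alpha> M\<^sub>2 f\<^sub>2"
    using transport_scale(1)[OF \<alpha> b, of f\<^sub>1 f\<^sub>2] L1 by (simp add: f2s in_Lalpha_def)
  moreover have "in_Lalpha \<alpha> M\<^sub>2 (?F2 t)" if "t \<in> carrier G" for t
    using transport_scale(1)[OF \<alpha> b F1 F2 F] F1L that by (simp add: in_Lalpha_def)
  moreover have "sas_rv \<alpha> P (\<lambda>\<omega>. \<Sum>t\<in>F. a t * X t \<omega>) ((LINT s|M\<^sub>2. \<bar>\<Sum>t\<in>F. a t * ?F2 t s\<bar> powr \<alpha>) powr (1 / \<alpha>))"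
    if Fc: "finite F" "F \<subseteq> carrier G" for F a
  proof -
    have "in_Lalpha \<alpha> M\<^sub>1 (\<lambda>s. \<Sum>t\<in>F. a t * ?F1 t s)"
      using \<alpha> Fc by (intro in_Lalpha_sum F1L) auto
    moreover have "(\<lambda>s. \<Sum>t\<in>F. a t * ?F2 t s) \<in> borel_measurable M\<^sub>2"
      using Fc by (intro borel_measurable_sum borel_measurable_times F2) auto
    ultimately have "(LINT s|M\<^sub>2. \<bar>\<Sum>t\<in>F. a t * ?F2 t s\<bar> powr \<alpha>) = (LINT s|M\<^sub>1. \<bar>\<Sum>t\<in>F. a t * ?F1 t s\<bar> powr \<alpha>)"
      by (intro transport_scale(2)[OF \<alpha> b] lin Fc) (auto simp: in_Lalpha_def)
    then show ?thesis using rep Fc by (simp add: integral_representation_def)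
  qed
  moreover have "AE s in M\<^sub>2. \<exists>t\<in>carrier G. ?F2 t s \<noteq> 0"
  proof -
    have 1: "AE s in M\<^sub>1. \<exists>t\<in>carrier G. ?F1 t s \<noteq> 0"
      using rep by (simp add: integral_representation_def)
    have 2: "AE s in M\<^sub>2. \<forall>t\<in>carrier G. ?F2 t s = scaling \<alpha> b s * ?F1 t (h' s)"
      by (rule AE_ball_countable'[OF F G])
    show ?thesis
      using AE_h'[OF 1] 2 scaling_nonzero[OF b, of \<alpha>] by eventually_elim simp
  qed
  ultimately show "rosinski_triplet \<alpha> G P X M\<^sub>2 f\<^sub>2 \<phi>\<^sub>2 c\<^sub>2"
    using na sc by (simp add: rosinski_triplet_def integral_representation_def)
  show "minimal_family G M\<^sub>2 ?F2" if "minimal_family G M\<^sub>1 ?F1"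
    by (rule minimal_family_transport[OF that scaling_nonzero[OF b] F1 F2 F])
qed

section \<open>Uniqueness of minimal triplets\<close>

text \<open>Unlike \<open>sgn\<close>, this is \<open>\<plusminus>1\<close>-valued everywhere.\<close>

definition sg :: "real \<Rightarrow> real" where
  "sg x = (if x < 0 then - 1 else 1)"

lemma sg_mult: "x \<noteq> 0 \<Longrightarrow> y \<noteq> 0 \<Longrightarrow> sg (x * y) = sg x * sg y"
  by (auto simp: sg_def zero_less_mult_iff mult_less_0_iff)

lemma sg_cases: "sg x = 1 \<or> sg x = - 1"
  by (simp add: sg_def)

lemma sg_measurable [measurable]: "sg \<in> borel_measurable borel"
  unfolding sg_def by measurable

lemma sg_sq [simp]: "sg x * sg x = 1" "sg x * (sg x * y) = y"
  using sg_cases[of x] by auto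

text \<open>Points of the product are extensional, so equality is a countable conjunction of
  coordinate equalities. This lets an identity between directions pass through
  \<open>AE_nu\<close>.\<close>

lemma measurable_eq_PiM:
  fixes f g :: "'a \<Rightarrow> 'i \<Rightarrow> real"
  assumes "countable I" and f: "f \<in> M \<rightarrow>\<^sub>M Pi\<^sub>M I (\<lambda>_. borel)" and g: "g \<in> M \<rightarrow>\<^sub>M Pi\<^sub>M I (\<lambda>_. borel)"
  shows "Measurable.pred M (\<lambda>s. f s = g s)"
proof -
  have [measurable]: "(\<lambda>s. f s t) \<in> borel_measurable M" "(\<lambda>s. g s t) \<in> borel_measurable M" if "t \<in> I" for t
    by (rule measurable_compose[OF f measurable_component_singleton[OF that]],
        rule measurable_compose[OF g measurable_component_singleton[OF that]])
  have "f s = g s \<longleftrightarrow> (\<forall>t\<in>I. f s t = g s t)" if s: "s \<in> space M" for s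
  proof
    assume eq: "\<forall>t\<in>I. f s t = g s t"
    have "f s \<in> Pi\<^sub>E I (\<lambda>_. UNIV)" "g s \<in> Pi\<^sub>E I (\<lambda>_. UNIV)"
      using measurable_space[OF f s] measurable_space[OF g s] by (simp_all add: space_PiM)
    then show "f s = g s" by (rule PiE_ext) (simp add: eq)
  qed simp
  then have "{s\<in>space M. f s = g s} = {s\<in>space M. \<forall>t\<in>I. f s t = g s t}" by blast
  also have "\<dots> \<in> sets M"
    by (rule sets.sets_Collect_countable_All'[OF _ assms(1)]) measurable
  finally show ?thesis by (simp add: pred_def)
qed

lemma ext_ratio_mult: "c \<noteq> 0 \<Longrightarrow> ext_ratio (c * x) (c * y) = ext_ratio x y"
  by (simp add: ext_ratio_def)

text \<open>Ratios depend only on the line through \<open>x\<close>. A negative leading coordinate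
  does no harm because a zero denominator gives \<infinity> whatever the sign of the
  numerator.\<close>

lemma ext_ratio_direction:
  assumes "countable I" "t \<in> I" "u \<in> I"
  shows "ext_ratio (x t) (x u) = ext_ratio (direction I x t) (direction I x u)"
proof (cases "lead I x = 0")
  case True
  then have "\<forall>t\<in>I. x t = 0" using assms by (subst lead_eq_0_iff[symmetric]) auto
  then show ?thesis using assms True by (simp add: direction_def)
next
  case False
  then show ?thesis
    using assms ext_ratio_mult[OF False, of "direction I x t" "direction I x u"] by (simp add: lead_times_direction)
qed

text \<open>Each generating ratio is a measurable function of the direction, so the generated sets
  are preimages under the direction map.\<close>

lemma ratio_algebra_direction:
  assumes G: "countable (carrier G)" "carrier G \<noteq> {}"
    and f: "\<And>t. t \<in> carrier G \<Longrightarrow> f t \<in> borel_measurable M"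
    and A: "A \<in> ratio_algebra G M f"
  shows "\<exists>D\<in>sets (Pi\<^sub>M (carrier G) (\<lambda>_. borel)). A = (\<lambda>s. direction (carrier G) (\<lambda>t. f t s)) -` D \<inter> space M"
proof -
  let ?Y = "Pi\<^sub>M (carrier G) (\<lambda>_. borel :: real measure)" and ?U = "\<lambda>s. direction (carrier G) (\<lambda>t. f t s)"
  have U: "?U \<in> space M \<rightarrow> space ?Y"
    using measurable_space[OF direction_measurable[OF G(2) f]] by auto
  let ?V = "vimage_algebra (space M) ?U ?Y"
  have UV: "?U \<in> ?V \<rightarrow>\<^sub>M ?Y" using U by (rule measurable_vimage_algebra1)
  have gens: "{(\<lambda>s. ext_ratio (f t s) (f u s)) -` E \<inter> space ?V | t u E.
      t \<in> carrier G \<and> u \<in> carrier G \<and> E \<in> sets borel} \<subseteq> sets ?V"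
  proof safe
    fix t u and E :: "ereal set" assume tu: "t \<in> carrier G" "u \<in> carrier G" and E: "E \<in> sets borel"
    have [measurable]: "(\<lambda>s. ?U s t) \<in> borel_measurable ?V" "(\<lambda>s. ?U s u) \<in> borel_measurable ?V"
      by (rule measurable_compose[OF UV measurable_component_singleton[OF tu(1)]],
          rule measurable_compose[OF UV measurable_component_singleton[OF tu(2)]])
    have "(\<lambda>s. ext_ratio (?U s t) (?U s u)) \<in> borel_measurable ?V"
      unfolding ext_ratio_def by measurable
    then show "(\<lambda>s. ext_ratio (f t s) (f u s)) -` E \<inter> space ?V \<in> sets ?V"
      unfolding ext_ratio_direction[OF G(1) tu, symmetric] using E by (rule measurable_sets)
  qed
  from A have "A \<in> sets ?V"
    using sets.sigma_sets_subset[OF gens] unfolding ratio_algebra_def space_vimage_algebra by blast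
  then show ?thesis using sets_vimage_algebra2[OF U] by auto
qed

section \<open>The direction map of a minimal triplet and its inverse\<close>

locale minimal_triplet_action = ns_action G M \<phi>
  for G :: "('g, 'm) monoid_scheme" (structure) and M :: "'a measure" and \<phi> :: "'g \<Rightarrow> 'a \<Rightarrow> 'a" +
  fixes \<alpha> :: real and f :: "'a \<Rightarrow> real" and c :: "'g \<Rightarrow> 'a \<Rightarrow> real" and P :: "'w measure" and X :: "'g \<Rightarrow> 'w \<Rightarrow> real"
  assumes alpha: "0 < \<alpha>" and countable_G: "countable (carrier G)"
    and minimal: "minimal_triplet \<alpha> G P X M f \<phi> c"
    and nonnull: "space M \<noteq> {}"
begin

abbreviation "I \<equiv> carrier G"
abbreviation "Y \<equiv> Pi\<^sub>M (carrier G) (\<lambda>_. borel :: real measure)"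

definition F where "F t = triplet_family \<alpha> G M f \<phi> c t"
definition k where "k s = lead I (\<lambda>t. F t s)"
definition U where "U s = direction I (\<lambda>t. F t s)"
definition \<nu> where "\<nu> = spectral_measure \<alpha> I M F"

lemma I_ne: "I \<noteq> {}" using one_closed by auto

lemma cocycle: "sign_cocycle G M \<phi> c"
  and rep: "integral_representation \<alpha> G P X M F"
  using minimal by (simp_all add: minimal_triplet_def rosinski_triplet_def F_def[abs_def])

lemma F_measurable [measurable]: "t \<in> I \<Longrightarrow> F t \<in> borel_measurable M"
  using rep by (simp add: integral_representation_def in_Lalpha_def)

lemma k_measurable [measurable]: "k \<in> borel_measurable M"
  unfolding k_def[abs_def] by (rule lead_measurable[OF I_ne F_measurable])

lemma U_measurable [measurable]: "U \<in> M \<rightarrow>\<^sub>M Y"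
  unfolding U_def[abs_def] by (rule direction_measurable[OF I_ne F_measurable])

lemma k_nonzero: "AE s in M. k s \<noteq> 0"
proof -
  have "AE s in M. \<exists>t\<in>I. F t s \<noteq> 0" using rep by (simp add: integral_representation_def)
  then show ?thesis
    by eventually_elim (simp add: k_def lead_eq_0_iff[OF countable_G I_ne])
qed

text \<open>By full support the density \<open>\<bar>k s\<bar> powr \<alpha>\<close> is positive
  almost everywhere, so \<open>\<nu>\<close> has the same null sets as the image of \<open>M\<close>
  under \<open>U\<close>.\<close>

lemma AE_nu:
  assumes Q: "Measurable.pred Y Q"
  shows "(AE y in \<nu>. Q y) \<longleftrightarrow> (AE s in M. Q (U s))"
proof -
  have nu: "\<nu> = distr (density M (\<lambda>s. ennreal (\<bar>k s\<bar> powr \<alpha>))) Y U"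
    by (simp add: \<nu>_def spectral_measure_def k_def[abs_def] U_def[abs_def])
  have "(AE y in \<nu>. Q y) \<longleftrightarrow> (AE s in density M (\<lambda>s. ennreal (\<bar>k s\<bar> powr \<alpha>)). Q (U s))"
    unfolding nu by (rule AE_distr_iff) (use Q in \<open>simp_all add: pred_def\<close>)
  also have "\<dots> \<longleftrightarrow> (AE s in M. 0 < ennreal (\<bar>k s\<bar> powr \<alpha>) \<longrightarrow> Q (U s))"
    by (rule AE_density) measurable
  also have "\<dots> \<longleftrightarrow> (AE s in M. Q (U s))"
  proof
    assume "AE s in M. 0 < ennreal (\<bar>k s\<bar> powr \<alpha>) \<longrightarrow> Q (U s)"
    then show "AE s in M. Q (U s)" using k_nonzero by eventually_elim simp
  next
    assume "AE s in M. Q (U s)"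
    then show "AE s in M. 0 < ennreal (\<bar>k s\<bar> powr \<alpha>) \<longrightarrow> Q (U s)" by eventually_elim simp
  qed
  finally show ?thesis .
qed

text \<open>Minimality makes every measurable set a ratio set modulo null sets, hence a preimage
  under \<open>U\<close>; these preimages allow points to be recovered.\<close>

lemma ex_inverse: "\<exists>g. g \<in> Y \<rightarrow>\<^sub>M M \<and> (AE s in M. g (U s) = s)"
proof (rule measurable_left_inverse_mod_null[OF _ nonnull U_measurable])
  show "standard_measure_space M" using nonsingular by (simp add: nonsingular_action_def)
  fix B assume B: "B \<in> sets M"
  have "minimal_family G M F" using minimal by (simp add: minimal_triplet_def F_def[abs_def])
  then obtain A where A: "A \<in> ratio_algebra G M F" "(A - B) \<union> (B - A) \<in> null_sets M"
    using B by (auto simp: minimal_family_def)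
  obtain D where D: "D \<in> sets Y" "A = U -` D \<inter> space M"
    using ratio_algebra_direction[OF countable_G I_ne F_measurable A(1)] unfolding U_def[abs_def] by blast
  have "AE s in M. s \<in> B \<longleftrightarrow> U s \<in> D"
    using AE_not_in[OF A(2)] AE_space by eventually_elim (auto simp: D(2))
  with D(1) show "\<exists>D\<in>sets Y. AE s in M. s \<in> B \<longleftrightarrow> U s \<in> D" by blast
qed

definition rec where "rec = (SOME g. g \<in> Y \<rightarrow>\<^sub>M M \<and> (AE s in M. g (U s) = s))"

lemma rec_measurable [measurable]: "rec \<in> Y \<rightarrow>\<^sub>M M"
  and rec_U: "AE s in M. rec (U s) = s"
  using someI_ex[OF ex_inverse] by (simp_all add: rec_def)

text \<open>Modulo a nonvanishing factor, \<open>s \<mapsto> (F t s)\<^sub>t\<close> intertwines \<open>\<phi>\<close> with the shift of coordinates;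
  the sign of that factor is the cocycle.\<close>

lemma shift_U:
  assumes t: "t \<in> I"
  shows "AE s in M. U (\<phi> t s) = direction I (\<lambda>v. U s (t \<otimes> v)) \<and>
     c t s = sg (lead I (\<lambda>v. U s (t \<otimes> v))) * sg (k s) * sg (k (\<phi> t s))"
  using triplet_family_mult[OF cocycle t countable_G, of \<alpha> f, folded F_def] k_nonzero w_nonzero[OF t] w_finite[OF t] AE_space
proof eventually_elim
  case (elim s)
  \<comment> \<open>The factor between the shifted family at \<open>s\<close> and the family at
    \<open>\<phi> t s\<close>. The derivative is positive here, so the sign of \<open>a\<close> is
    \<open>c t s\<close>.\<close>
  define a where "a = c t s * enn2real (w t s) powr (1 / \<alpha>)"
  have "enn2real (w t s) \<noteq> 0" using elim by (auto simp: enn2real_eq_0_iff)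
  then have "0 < enn2real (w t s)" by (simp add: less_le)
  moreover have c: "c t s = 1 \<or> c t s = - 1"
    using cocycle t elim by (auto simp: sign_cocycle_def sign_map_def)
  ultimately have a: "a \<noteq> 0" "sg a = c t s" by (auto simp: a_def sg_def)
  have x: "U s (t \<otimes> v) = (a / k s) * F v (\<phi> t s)" if v: "v \<in> I" for v
  proof -
    have "k s * U s (t \<otimes> v) = F (t \<otimes> v) s"
      unfolding k_def U_def using t v by (intro lead_times_direction countable_G) simp
    also have "\<dots> = a * F v (\<phi> t s)" using elim(1) v by (simp add: a_def)
    finally show ?thesis using elim(2) by (simp add: field_simps)
  qed
  have ne: "a / k s \<noteq> 0" using a elim by simp
  have "direction I (\<lambda>v. U s (t \<otimes> v)) = U (\<phi> t s)"
    unfolding U_def[of "\<phi> t s"] by (rule direction_scale[OF x ne I_ne])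
  moreover have l: "lead I (\<lambda>v. U s (t \<otimes> v)) = (a / k s) * k (\<phi> t s)"
    unfolding k_def[of "\<phi> t s"] by (rule lead_scale[OF x ne I_ne])
  \<comment> \<open>Every \<open>v\<close> equals \<open>t \<otimes> (inv t \<otimes> v)\<close>, so
    a family vanishing at \<open>\<phi> t s\<close> would vanish at \<open>s\<close> as
    well.\<close>
  moreover have "k (\<phi> t s) \<noteq> 0"
  proof
    assume "k (\<phi> t s) = 0"
    then have z: "F v (\<phi> t s) = 0" if "v \<in> I" for v
      using that lead_eq_0_iff[OF countable_G I_ne] by (simp add: k_def)
    have "F v s = 0" if v: "v \<in> I" for v
    proof -
      have "F (t \<otimes> (inv t \<otimes> v)) s = 0" using elim(1) z[of "inv t \<otimes> v"] t v by simp
      then show ?thesis using t v by (simp add: m_assoc[symmetric])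
    qed
    then show False using elim(2) lead_eq_0_iff[OF countable_G I_ne] by (simp add: k_def)
  qed
  \<comment> \<open>Taking signs in \<open>l\<close> and solving for \<open>sg a\<close> gives the
    formula for \<open>c t s\<close>, since signs are their own inverses.\<close>
  ultimately show ?case
    using a c elim(2) sg_cases[of "k s"] sg_cases[of "k (\<phi> t s)"]
      sg_mult[of a "k (\<phi> t s) / k s"] sg_mult[of "k s" "k (\<phi> t s) / k s"] by auto
qed

end

section \<open>The isomorphism between two minimal triplets with a common law of directions\<close>

locale two_minimal_triplets = T\<^sub>1: minimal_triplet_action G M\<^sub>1 \<phi>\<^sub>1 \<alpha> f\<^sub>1 c\<^sub>1 P X + T\<^sub>2: minimal_triplet_action G M\<^sub>2 \<phi>\<^sub>2 \<alpha> f\<^sub>2 c\<^sub>2 P X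
  for G :: "('g, 'm) monoid_scheme" (structure) and M\<^sub>1 :: "'a measure" and \<phi>\<^sub>1 and M\<^sub>2 :: "'b measure" and \<phi>\<^sub>2 \<alpha> f\<^sub>1 c\<^sub>1 f\<^sub>2 c\<^sub>2
    and P :: "'w measure" and X +
  assumes nu_eq: "T\<^sub>1.\<nu> = T\<^sub>2.\<nu>"
begin

text \<open>The identity \<open>T\<^sub>2.U (T\<^sub>2.rec y) = y\<close> holds almost everywhere
  for the second law of directions, and the first law is the same measure.\<close>

lemma U_rec_U: "AE s in M\<^sub>1. T\<^sub>2.U (T\<^sub>2.rec (T\<^sub>1.U s)) = T\<^sub>1.U s"
proof -
  have m: "Measurable.pred T\<^sub>1.Y (\<lambda>y. T\<^sub>2.U (T\<^sub>2.rec y) = y)"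
    by (rule measurable_eq_PiM[OF T\<^sub>1.countable_G]) measurable
  have "AE s in M\<^sub>2. T\<^sub>2.U (T\<^sub>2.rec (T\<^sub>2.U s)) = T\<^sub>2.U s"
    using T\<^sub>2.rec_U by eventually_elim simp
  then have "AE y in T\<^sub>2.\<nu>. T\<^sub>2.U (T\<^sub>2.rec y) = y" by (subst T\<^sub>2.AE_nu[OF m])
  then show ?thesis unfolding nu_eq[symmetric] by (subst (asm) T\<^sub>1.AE_nu[OF m])
qed

definition h where "h s = T\<^sub>2.rec (T\<^sub>1.U s)"

lemma h_measurable [measurable]: "h \<in> M\<^sub>1 \<rightarrow>\<^sub>M M\<^sub>2"
  unfolding h_def[abs_def] by measurable

text \<open>Nullity of \<open>A\<close> for either measure means that \<open>T\<^sub>2.rec y\<close>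
  avoids \<open>A\<close> for almost every \<open>y\<close> under the common law.\<close>

lemma equiv_h: "equiv_measure (distr M\<^sub>1 M\<^sub>2 h) M\<^sub>2"
proof -
  have "A \<in> null_sets (distr M\<^sub>1 M\<^sub>2 h) \<longleftrightarrow> A \<in> null_sets M\<^sub>2" if A [measurable]: "A \<in> sets M\<^sub>2" for A
  proof -
    have m: "Measurable.pred T\<^sub>1.Y (\<lambda>y. T\<^sub>2.rec y \<notin> A)" by measurable
    have "A \<in> null_sets (distr M\<^sub>1 M\<^sub>2 h) \<longleftrightarrow> (AE y in distr M\<^sub>1 M\<^sub>2 h. y \<notin> A)"
      by (rule AE_iff_null_sets) simp
    also have "\<dots> \<longleftrightarrow> (AE s in M\<^sub>1. h s \<notin> A)"
      by (rule AE_distr_iff) auto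
    also have "\<dots> \<longleftrightarrow> (AE y in T\<^sub>2.\<nu>. T\<^sub>2.rec y \<notin> A)"
      unfolding h_def nu_eq[symmetric] by (rule T\<^sub>1.AE_nu[OF m, symmetric])
    also have "\<dots> \<longleftrightarrow> (AE s in M\<^sub>2. T\<^sub>2.rec (T\<^sub>2.U s) \<notin> A)"
      by (rule T\<^sub>2.AE_nu[OF m])
    also have "\<dots> \<longleftrightarrow> (AE s in M\<^sub>2. s \<notin> A)"
    proof
      assume "AE s in M\<^sub>2. T\<^sub>2.rec (T\<^sub>2.U s) \<notin> A"
      then show "AE s in M\<^sub>2. s \<notin> A" using T\<^sub>2.rec_U by eventually_elim simp
    next
      assume "AE s in M\<^sub>2. s \<notin> A"
      then show "AE s in M\<^sub>2. T\<^sub>2.rec (T\<^sub>2.U s) \<notin> A" using T\<^sub>2.rec_U by eventually_elim simp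
    qed
    also have "\<dots> \<longleftrightarrow> A \<in> null_sets M\<^sub>2"
      by (rule AE_iff_null_sets[symmetric]) simp
    finally show ?thesis .
  qed
  then have "null_sets (distr M\<^sub>1 M\<^sub>2 h) = null_sets M\<^sub>2"
    by (intro Set.set_eqI) (metis null_setsD2 sets_distr)
  then show ?thesis by (simp add: equiv_measure_def absolutely_continuous_def)
qed

lemma AE_h: "AE s in M\<^sub>2. Q s \<Longrightarrow> AE s in M\<^sub>1. Q (h s)"
  using equiv_h by (rule_tac AE_compose_ac[where P=Q and N=M\<^sub>2]) (simp_all add: equiv_measure_def)

text \<open>By \<open>shift_U\<close>, each action is the same operation on directions, namely
  shifting coordinates and renormalising; \<open>h\<close> matches directions.\<close>

lemma h_phi:
  assumes t: "t \<in> carrier G"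
  shows "AE s in M\<^sub>1. h (\<phi>\<^sub>1 t s) = \<phi>\<^sub>2 t (h s)"
proof -
  have "AE s in M\<^sub>2. \<phi>\<^sub>2 t s = T\<^sub>2.rec (direction (carrier G) (\<lambda>v. T\<^sub>2.U s (t \<otimes> v)))"
    using T\<^sub>2.shift_U[OF t] T\<^sub>2.AE_phi[OF t T\<^sub>2.rec_U] by eventually_elim simp
  from AE_h[OF this] T\<^sub>1.shift_U[OF t] U_rec_U show ?thesis
    by eventually_elim (simp add: h_def)
qed

end

text \<open>The hypotheses are symmetric, so exchanging the triplets gives a map in the other
  direction. The two maps are inverse to each other because both preserve directions.\<close>

lemma minimal_triplets_approx:
  assumes "two_minimal_triplets G M\<^sub>1 \<phi>\<^sub>1 M\<^sub>2 \<phi>\<^sub>2 \<alpha> f\<^sub>1 c\<^sub>1 f\<^sub>2 c\<^sub>2 P X"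
  shows "\<exists>h h' b. approx_via G M\<^sub>1 \<phi>\<^sub>1 c\<^sub>1 M\<^sub>2 \<phi>\<^sub>2 c\<^sub>2 h h' b"
proof -
  interpret A: two_minimal_triplets G M\<^sub>1 \<phi>\<^sub>1 M\<^sub>2 \<phi>\<^sub>2 \<alpha> f\<^sub>1 c\<^sub>1 f\<^sub>2 c\<^sub>2 P X by fact
  interpret B: two_minimal_triplets G M\<^sub>2 \<phi>\<^sub>2 M\<^sub>1 \<phi>\<^sub>1 \<alpha> f\<^sub>2 c\<^sub>2 f\<^sub>1 c\<^sub>1 P X
    by unfold_locales (simp add: A.nu_eq)
  have inv1: "AE s in M\<^sub>1. B.h (A.h s) = s"
    using A.U_rec_U A.T\<^sub>1.rec_U by eventually_elim (simp add: A.h_def B.h_def)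
  have inv2: "AE s in M\<^sub>2. A.h (B.h s) = s"
    using B.U_rec_U A.T\<^sub>2.rec_U by eventually_elim (simp add: A.h_def B.h_def)
  have conj: "conjugate_via G M\<^sub>1 \<phi>\<^sub>1 M\<^sub>2 \<phi>\<^sub>2 A.h B.h"
    unfolding conjugate_via_def using inv1 inv2 A.equiv_h A.h_phi by simp
  \<comment> \<open>In the formulas of \<open>shift_U\<close> for the two cocycles the factor
    depending on the direction is common. Their quotient consists of the signs of both leading
    coordinates at \<open>s\<close> and at \<open>\<phi>\<^sub>2 t s\<close>.\<close>
  define b where "b s = sg (A.T\<^sub>1.k (B.h s)) * sg (A.T\<^sub>2.k s)" for s
  have b: "sign_map M\<^sub>2 b"
    unfolding sign_map_def
  proof
    show "b \<in> borel_measurable M\<^sub>2" unfolding b_def[abs_def] by measurable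
    show "\<forall>s\<in>space M\<^sub>2. b s \<in> {1, - 1}" unfolding b_def using sg_cases by (metis insertI1 insertI2 minus_mult_minus mult.left_neutral mult.right_neutral singletonI)
  qed
  have coc: "AE s in M\<^sub>2. c\<^sub>1 t (B.h s) = c\<^sub>2 t s * (b (\<phi>\<^sub>2 t s) / b s)" if t: "t \<in> carrier G" for t
    using B.AE_h[OF A.T\<^sub>1.shift_U[OF t]] A.T\<^sub>2.shift_U[OF t] B.U_rec_U B.h_phi[OF t]
  proof eventually_elim
    case (elim s)
    have u: "A.T\<^sub>1.U (B.h s) = A.T\<^sub>2.U s" using elim(3) by (simp add: B.h_def)
    show ?case
      using elim u sg_cases[of "A.T\<^sub>1.k (B.h s)"] sg_cases[of "A.T\<^sub>2.k s"] sg_cases[of "A.T\<^sub>2.k (\<phi>\<^sub>2 t s)"]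
      unfolding b_def by auto
  qed
  show ?thesis
    unfolding approx_via_def using conj b coc by blast
qed

section \<open>Scales are determined by the field\<close>

lemma sas_rv_scale_unique:
  assumes "sas_rv \<alpha> P Z \<sigma>" "sas_rv \<alpha> P Z \<tau>"
  shows "\<sigma> powr \<alpha> = \<tau> powr \<alpha>"
proof -
  \<comment> \<open>Both forms of the characteristic function are compared at \<theta> = 1.\<close>
  have "complex_of_real (exp (- (\<sigma> powr \<alpha>))) = complex_of_real (exp (- (\<tau> powr \<alpha>)))"
    using assms unfolding sas_rv_def by (metis abs_one mult.right_neutral powr_one_eq_one)
  then show ?thesis by simp
qed

lemma representation_sas_rv:
  assumes "integral_representation \<alpha> G P X M f" "finite F" "F \<subseteq> carrier G"
  shows "sas_rv \<alpha> P (\<lambda>\<omega>. \<Sum>t\<in>F. a t * X t \<omega>) ((LINT s|M. \<bar>\<Sum>t\<in>F. a t * f t s\<bar> powr \<alpha>) powr (1 / \<alpha>))"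
  using assms by (simp add: integral_representation_def)

text \<open>Over an empty space the scale integral is 0, against the positive scale of
  \<open>X t\<close>. A point of the space serves as default value when the direction map is
  inverted.\<close>

lemma representation_nonempty:
  assumes \<alpha>: "0 < \<alpha>" and t: "t \<in> carrier G" and \<sigma>: "\<sigma> > 0" "sas_rv \<alpha> P (X t) \<sigma>"
    and rep: "integral_representation \<alpha> G P X M ft"
  shows "space M \<noteq> {}"
proof
  assume e: "space M = {}"
  have "sas_rv \<alpha> P (X t) ((LINT s|M. \<bar>ft t s\<bar> powr \<alpha>) powr (1 / \<alpha>))"
    using representation_sas_rv[OF rep, of "{t}" "\<lambda>_. 1"] t by simp
  moreover have "(LINT s|M. \<bar>ft t s\<bar> powr \<alpha>) = 0"
    using e Bochner_Integration.integral_cong[of M M "\<lambda>s. \<bar>ft s\<bar> powr \<alpha>" "\<lambda>_. 0" for ft] by simp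
  ultimately have "\<sigma> powr \<alpha> = (0 powr (1/\<alpha>)) powr \<alpha>"
    using sas_rv_scale_unique[OF \<sigma>(2)] by simp
  then show False using \<sigma>(1) by simp
qed

lemma representations_equal_scales:
  assumes \<alpha>: "0 < \<alpha>" "\<alpha> < 2" and M: "sigma_finite_measure M" "sigma_finite_measure N"
    and r: "integral_representation \<alpha> G P X M f" "integral_representation \<alpha> G P X N g"
  shows "equal_scales \<alpha> (carrier G) M N f g"
proof (rule equal_scales.intro)
  show "t \<in> carrier G \<Longrightarrow> in_Lalpha \<alpha> M (f t)" "t \<in> carrier G \<Longrightarrow> in_Lalpha \<alpha> N (g t)" for t
    using r unfolding integral_representation_def by blast+
  fix F a assume F: "finite F" "F \<subseteq> carrier G"
  have "((LINT s|M. \<bar>\<Sum>t\<in>F. a t * f t s\<bar> powr \<alpha>) powr (1 / \<alpha>)) powr \<alpha> = ((LINT s|N. \<bar>\<Sum>t\<in>F. a t * g t s\<bar> powr \<alpha>) powr (1 / \<alpha>)) powr \<alpha>"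
    using r F by (intro sas_rv_scale_unique[OF representation_sas_rv representation_sas_rv])
  then show "(LINT s|M. \<bar>\<Sum>t\<in>F. a t * f t s\<bar> powr \<alpha>) = (LINT s|N. \<bar>\<Sum>t\<in>F. a t * g t s\<bar> powr \<alpha>)"
    using \<alpha> by (simp add: powr_powr)
qed (fact \<alpha> M)+

theorem theorem5p2:
  fixes \<alpha> :: real and G :: "('g, 'm) monoid_scheme"
    and P :: "'w measure" and X :: "'g \<Rightarrow> 'w \<Rightarrow> real"
    and M\<^sub>1 :: "'a measure" and M\<^sub>2 :: "'b measure"
  assumes "0 < \<alpha>" "\<alpha> < 2"
    and "group G" "countable (carrier G)"
    and "prob_space P" "sas_field \<alpha> G P X" "stationary_field G P X"
  shows
    "(\<forall>f\<^sub>1 \<phi>\<^sub>1 c\<^sub>1 \<phi>\<^sub>2 c\<^sub>2 h h' b f\<^sub>2.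
        rosinski_triplet \<alpha> G P X M\<^sub>1 f\<^sub>1 \<phi>\<^sub>1 c\<^sub>1 \<and>
        nonsingular_action G M\<^sub>2 \<phi>\<^sub>2 \<and> sign_cocycle G M\<^sub>2 \<phi>\<^sub>2 c\<^sub>2 \<and>
        approx_via G M\<^sub>1 \<phi>\<^sub>1 c\<^sub>1 M\<^sub>2 \<phi>\<^sub>2 c\<^sub>2 h h' b \<and>
        f\<^sub>2 = transported_function \<alpha> M\<^sub>1 M\<^sub>2 f\<^sub>1 h h' b \<longrightarrow>
        rosinski_triplet \<alpha> G P X M\<^sub>2 f\<^sub>2 \<phi>\<^sub>2 c\<^sub>2 \<and>
        (minimal_triplet \<alpha> G P X M\<^sub>1 f\<^sub>1 \<phi>\<^sub>1 c\<^sub>1 \<longrightarrow>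
         minimal_triplet \<alpha> G P X M\<^sub>2 f\<^sub>2 \<phi>\<^sub>2 c\<^sub>2)) \<and>
     (\<forall>f\<^sub>1 \<phi>\<^sub>1 c\<^sub>1 f\<^sub>2 \<phi>\<^sub>2 c\<^sub>2.
        minimal_triplet \<alpha> G P X M\<^sub>1 f\<^sub>1 \<phi>\<^sub>1 c\<^sub>1 \<and>
        minimal_triplet \<alpha> G P X M\<^sub>2 f\<^sub>2 \<phi>\<^sub>2 c\<^sub>2 \<longrightarrow>
        approx G M\<^sub>1 \<phi>\<^sub>1 c\<^sub>1 M\<^sub>2 \<phi>\<^sub>2 c\<^sub>2 \<and>
        conjugate G M\<^sub>1 \<phi>\<^sub>1 M\<^sub>2 \<phi>\<^sub>2)"
proof (intro conjI allI impI)
  fix f\<^sub>1 :: "'a \<Rightarrow> real" and \<phi>\<^sub>1 c\<^sub>1 and \<phi>\<^sub>2 :: "'g \<Rightarrow> 'b \<Rightarrow> 'b" and c\<^sub>2 h h' b f\<^sub>2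
  assume *: "rosinski_triplet \<alpha> G P X M\<^sub>1 f\<^sub>1 \<phi>\<^sub>1 c\<^sub>1 \<and>
        nonsingular_action G M\<^sub>2 \<phi>\<^sub>2 \<and> sign_cocycle G M\<^sub>2 \<phi>\<^sub>2 c\<^sub>2 \<and>
        approx_via G M\<^sub>1 \<phi>\<^sub>1 c\<^sub>1 M\<^sub>2 \<phi>\<^sub>2 c\<^sub>2 h h' b \<and>
        f\<^sub>2 = transported_function \<alpha> M\<^sub>1 M\<^sub>2 f\<^sub>1 h h' b"
  then show R: "rosinski_triplet \<alpha> G P X M\<^sub>2 f\<^sub>2 \<phi>\<^sub>2 c\<^sub>2"
    using approx_transports_triplet(1)[OF assms(1,3,4)] by blast
  assume "minimal_triplet \<alpha> G P X M\<^sub>1 f\<^sub>1 \<phi>\<^sub>1 c\<^sub>1"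
  with * R show "minimal_triplet \<alpha> G P X M\<^sub>2 f\<^sub>2 \<phi>\<^sub>2 c\<^sub>2"
    using approx_transports_triplet(2)[OF assms(1,3,4)] unfolding minimal_triplet_def by blast
next
  interpret group G by fact
  fix f\<^sub>1 :: "'a \<Rightarrow> real" and \<phi>\<^sub>1 c\<^sub>1 and f\<^sub>2 :: "'b \<Rightarrow> real" and \<phi>\<^sub>2 c\<^sub>2
  assume *: "minimal_triplet \<alpha> G P X M\<^sub>1 f\<^sub>1 \<phi>\<^sub>1 c\<^sub>1 \<and> minimal_triplet \<alpha> G P X M\<^sub>2 f\<^sub>2 \<phi>\<^sub>2 c\<^sub>2"
  then have R: "rosinski_triplet \<alpha> G P X M\<^sub>1 f\<^sub>1 \<phi>\<^sub>1 c\<^sub>1" "rosinski_triplet \<alpha> G P X M\<^sub>2 f\<^sub>2 \<phi>\<^sub>2 c\<^sub>2"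
    by (simp_all add: minimal_triplet_def)
  have rep: "integral_representation \<alpha> G P X M\<^sub>1 (triplet_family \<alpha> G M\<^sub>1 f\<^sub>1 \<phi>\<^sub>1 c\<^sub>1)"
    "integral_representation \<alpha> G P X M\<^sub>2 (triplet_family \<alpha> G M\<^sub>2 f\<^sub>2 \<phi>\<^sub>2 c\<^sub>2)"
    using R by (simp_all add: rosinski_triplet_def)
  \<comment> \<open>The positive scale at the identity element makes both spaces nonempty.\<close>
  obtain \<sigma> where \<sigma>: "\<sigma> > 0" "sas_rv \<alpha> P (X \<one>\<^bsub>G\<^esub>) \<sigma>"
    using assms(6) one_closed unfolding sas_field_def by blast
  have ne: "space M\<^sub>1 \<noteq> {}" "space M\<^sub>2 \<noteq> {}"
    using representation_nonempty[where X=X and t="\<one>\<^bsub>G\<^esub>", OF assms(1) one_closed \<sigma>] rep by blast+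
  interpret T\<^sub>1: minimal_triplet_action G M\<^sub>1 \<phi>\<^sub>1 \<alpha> f\<^sub>1 c\<^sub>1 P X
    by unfold_locales (use R ne * assms in \<open>simp_all add: rosinski_triplet_def\<close>)
  interpret T\<^sub>2: minimal_triplet_action G M\<^sub>2 \<phi>\<^sub>2 \<alpha> f\<^sub>2 c\<^sub>2 P X
    by unfold_locales (use R ne * assms in \<open>simp_all add: rosinski_triplet_def\<close>)
  interpret equal_scales \<alpha> "carrier G" M\<^sub>1 M\<^sub>2 T\<^sub>1.F T\<^sub>2.F
    by (rule representations_equal_scales[OF assms(1,2) T\<^sub>1.sigma_finite_measure_axioms T\<^sub>2.sigma_finite_measure_axioms T\<^sub>1.rep T\<^sub>2.rep])
  \<comment> \<open>Equal scales give equal spectral measures, which is the assumption linking the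
    two triplets.\<close>
  have "two_minimal_triplets G M\<^sub>1 \<phi>\<^sub>1 M\<^sub>2 \<phi>\<^sub>2 \<alpha> f\<^sub>1 c\<^sub>1 f\<^sub>2 c\<^sub>2 P X"
    by unfold_locales (simp add: T\<^sub>1.\<nu>_def T\<^sub>2.\<nu>_def spectral_measure_eq[OF assms(4) T\<^sub>1.I_ne])
  from minimal_triplets_approx[OF this]
  show "approx G M\<^sub>1 \<phi>\<^sub>1 c\<^sub>1 M\<^sub>2 \<phi>\<^sub>2 c\<^sub>2" and "conjugate G M\<^sub>1 \<phi>\<^sub>1 M\<^sub>2 \<phi>\<^sub>2"
    by (auto simp: approx_def conjugate_def approx_via_def)
qed

end
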